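(* Let $u$ be the solution of $u''(t)+\alpha u'(t)+Au(t)=0$ for $t>0$, with $u(0)=u_0$, $u'(0)=u_1$, and let $0<\delta\le \frac13\min\left(\alpha,\frac{\lambda_1}{2\alpha}\right)$. Let $j\ge 1$ be an integer. (i) With $\mathcal{E}_A^{(j)}(u)(t)=\frac12\left(\|A^{1/2}u^{(j)}(t)\|^2+\|Au^{(j-1)}(t)\|^2\right)$, $$\mathcal{E}_A^{(j)}(u)(t)\le 3\,e^{-2\delta t}\,\mathcal{E}_A^{(j)}(u)(0),\qquad t\ge0.$$ (ii) Assume that $u_0\in D(A^{k})$ and $u_1\in D(A^{k-1/2})$ for $k>1$. Then, with $\mathcal{E}_{A^{(k)}}^{(j)}(u)(t)=\frac12\left(\|A^{k-1/2}u^{(j)}(t)\|^2+\|A^{k}u^{(j-1)}(t)\|^2\right)$, $$\mathcal{E}_{A^{(k)}}^{(j)}(u)(t)\le 3\,e^{-2\delta t}\,\mathcal{E}_{A^{(k)}}^{(j)}(u)(0),\qquad t\ge0.$$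
   Context: $\Omega\subset\mathbb{R}^d$ is a convex polygonal or polyhedral domain and $\alpha>0$ is a fixed constant. $\mathbf{A}(x)$ is a real symmetric, uniformly positive definite matrix and $a_0(x)\ge 0$, with smooth coefficients. $\|\cdot\|$ is the norm of $L^2(\Omega)$. $A$ is the self-adjoint positive definite operator on $L^2(\Omega)$ given by $A\phi=-\nabla\cdot(\mathbf{A}(x)\nabla\phi)+a_0(x)\phi$ with domain $D(A)=H^2(\Omega)\cap H^1_0(\Omega)$; $A^{s}$ denotes its power of order $s$, with domain $D(A^{s})$, and $D(A^{1/2})=H_0^1(\Omega)$. $\lambda_1>0$ is the principal (smallest) eigenvalue of $A$. $u^{(j)}$ is the $j$-th time derivative of $u$, $u^{(0)}=u$. *)

theory Defs
  imports "HOL-Analysis.Analysis"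
begin

section \<open>Domains and smooth functions\<close>

text \<open>Polygonal and polyhedral domains are bounded; a convex one is the interior of a
  full-dimensional convex polytope.\<close>

definition convex_polyhedral_domain :: "(real^'n) set \<Rightarrow> bool" where
  "convex_polyhedral_domain \<Omega> \<longleftrightarrow> \<Omega> \<noteq> {} \<and> (\<exists>P. polytope P \<and> \<Omega> = interior P)"

definition partial :: "'n \<Rightarrow> (real^'n \<Rightarrow> real) \<Rightarrow> real^'n \<Rightarrow> real" where
  "partial i f x = frechet_derivative f (at x) (axis i 1)"

fun Ck_on :: "nat \<Rightarrow> (real^'n \<Rightarrow> real) \<Rightarrow> (real^'n) set \<Rightarrow> bool" where
  "Ck_on 0 f S \<longleftrightarrow> continuous_on S f"
| "Ck_on (Suc m) f S \<longleftrightarrow> f differentiable_on S \<and> (\<forall>i. Ck_on m (partial i f) S)"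

text \<open>Only meaningful for open sets.\<close>

definition smooth_on :: "(real^'n) set \<Rightarrow> (real^'n \<Rightarrow> real) \<Rightarrow> bool" where
  "smooth_on S f \<longleftrightarrow> (\<forall>m. Ck_on m f S)"

definition smooth_upto_boundary :: "(real^'n) set \<Rightarrow> (real^'n \<Rightarrow> real) \<Rightarrow> bool" where
  "smooth_upto_boundary \<Omega> f \<longleftrightarrow> (\<exists>U. open U \<and> closure \<Omega> \<subseteq> U \<and> smooth_on U f)"

definition test_function :: "(real^'n) set \<Rightarrow> (real^'n \<Rightarrow> real) \<Rightarrow> bool" where
  "test_function \<Omega> \<phi> \<longleftrightarrow> smooth_on UNIV \<phi> \<and>
     compact (closure {x. \<phi> x \<noteq> 0}) \<and> closure {x. \<phi> x \<noteq> 0} \<subseteq> \<Omega>"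


section \<open>The space \<open>L\<^sup>2(\<Omega>)\<close>\<close>

text \<open>Elements are represented by functions; equality in the space is equality almost
  everywhere on \<open>\<Omega>\<close>, and all notions below are invariant under it. Values outside \<open>\<Omega>\<close>
  are irrelevant.\<close>

definition L2 :: "(real^'n) set \<Rightarrow> (real^'n \<Rightarrow> real) set" where
  "L2 \<Omega> = {f. f \<in> borel_measurable (lebesgue_on \<Omega>) \<and>
               integrable (lebesgue_on \<Omega>) (\<lambda>x. (f x)\<^sup>2)}"

definition L2_eq :: "(real^'n) set \<Rightarrow> (real^'n \<Rightarrow> real) \<Rightarrow> (real^'n \<Rightarrow> real) \<Rightarrow> bool" where
  "L2_eq \<Omega> f g \<longleftrightarrow> (AE x in lebesgue_on \<Omega>. f x = g x)"

definition L2_inner :: "(real^'n) set \<Rightarrow> (real^'n \<Rightarrow> real) \<Rightarrow> (real^'n \<Rightarrow> real) \<Rightarrow> real" where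
  "L2_inner \<Omega> f g = (LINT x|lebesgue_on \<Omega>. f x * g x)"

definition L2_norm :: "(real^'n) set \<Rightarrow> (real^'n \<Rightarrow> real) \<Rightarrow> real" where
  "L2_norm \<Omega> f = sqrt (L2_inner \<Omega> f f)"


section \<open>Sobolev spaces\<close>

definition has_weak_partial ::
  "(real^'n) set \<Rightarrow> 'n \<Rightarrow> (real^'n \<Rightarrow> real) \<Rightarrow> (real^'n \<Rightarrow> real) \<Rightarrow> bool" where
  "has_weak_partial \<Omega> i f g \<longleftrightarrow> f \<in> L2 \<Omega> \<and> g \<in> L2 \<Omega> \<and>
     (\<forall>\<phi>. test_function \<Omega> \<phi> \<longrightarrow> L2_inner \<Omega> f (partial i \<phi>) = - L2_inner \<Omega> g \<phi>)"

definition weak_partial ::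
  "(real^'n) set \<Rightarrow> 'n \<Rightarrow> (real^'n \<Rightarrow> real) \<Rightarrow> real^'n \<Rightarrow> real" where
  "weak_partial \<Omega> i f = (SOME g. has_weak_partial \<Omega> i f g)"

definition H1 :: "(real^'n) set \<Rightarrow> (real^'n \<Rightarrow> real) set" where
  "H1 \<Omega> = {f \<in> L2 \<Omega>. \<forall>i. \<exists>g. has_weak_partial \<Omega> i f g}"

definition H2 :: "(real^'n) set \<Rightarrow> (real^'n \<Rightarrow> real) set" where
  "H2 \<Omega> = {f \<in> H1 \<Omega>. \<forall>i. weak_partial \<Omega> i f \<in> H1 \<Omega>}"

definition H10 :: "(real^'n) set \<Rightarrow> (real^'n \<Rightarrow> real) set" where
  "H10 \<Omega> = {f \<in> H1 \<Omega>. \<exists>\<phi>. (\<forall>m::nat. test_function \<Omega> (\<phi> m)) \<and>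
     (\<lambda>m. L2_norm \<Omega> (\<lambda>x. \<phi> m x - f x)) \<longlonglongrightarrow> 0 \<and>
     (\<forall>i. (\<lambda>m. L2_norm \<Omega> (\<lambda>x. partial i (\<phi> m) x - weak_partial \<Omega> i f x)) \<longlonglongrightarrow> 0)}"


section \<open>The elliptic operator\<close>

definition elliptic_coefficients ::
  "(real^'n) set \<Rightarrow> (real^'n \<Rightarrow> real^'n^'n) \<Rightarrow> (real^'n \<Rightarrow> real) \<Rightarrow> bool" where
  "elliptic_coefficients \<Omega> M a0 \<longleftrightarrow>
     (\<forall>i j. smooth_upto_boundary \<Omega> (\<lambda>x. M x $ i $ j)) \<and>
     smooth_upto_boundary \<Omega> a0 \<and>
     (\<forall>x\<in>\<Omega>. transpose (M x) = M x) \<and>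
     (\<exists>c>0. \<forall>x\<in>\<Omega>. \<forall>\<xi>. \<xi> \<bullet> (M x *v \<xi>) \<ge> c * (norm \<xi>)\<^sup>2) \<and>
     (\<forall>x\<in>\<Omega>. a0 x \<ge> 0)"

definition op_dom :: "(real^'n) set \<Rightarrow> (real^'n \<Rightarrow> real) set" where
  "op_dom \<Omega> = H2 \<Omega> \<inter> H10 \<Omega>"

definition ell_op ::
  "(real^'n) set \<Rightarrow> (real^'n \<Rightarrow> real^'n^'n) \<Rightarrow> (real^'n \<Rightarrow> real) \<Rightarrow>
   (real^'n \<Rightarrow> real) \<Rightarrow> real^'n \<Rightarrow> real" where
  "ell_op \<Omega> M a0 \<phi> = (\<lambda>x.
     - (\<Sum>i\<in>UNIV. weak_partial \<Omega> i (\<lambda>y. \<Sum>j\<in>UNIV. M y $ i $ j * weak_partial \<Omega> j \<phi> y) x)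
     + a0 x * \<phi> x)"

text \<open>A densely defined operator \<open>T\<close> with domain \<open>D\<close> that is symmetric and whose adjoint
  has no larger domain.\<close>

definition self_adjoint_op ::
  "(real^'n) set \<Rightarrow> (real^'n \<Rightarrow> real) set \<Rightarrow>
   ((real^'n \<Rightarrow> real) \<Rightarrow> real^'n \<Rightarrow> real) \<Rightarrow> bool" where
  "self_adjoint_op \<Omega> D T \<longleftrightarrow>
     (\<forall>\<phi>\<in>D. \<phi> \<in> L2 \<Omega> \<and> T \<phi> \<in> L2 \<Omega>) \<and>
     (\<forall>v\<in>L2 \<Omega>. \<forall>\<epsilon>>0. \<exists>\<phi>\<in>D. L2_norm \<Omega> (\<lambda>x. v x - \<phi> x) < \<epsilon>) \<and>
     (\<forall>\<phi>\<in>D. \<forall>\<psi>\<in>D. L2_inner \<Omega> (T \<phi>) \<psi> = L2_inner \<Omega> \<phi> (T \<psi>)) \<and>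
     (\<forall>v\<in>L2 \<Omega>. \<forall>w\<in>L2 \<Omega>.
        (\<forall>\<phi>\<in>D. L2_inner \<Omega> (T \<phi>) v = L2_inner \<Omega> \<phi> w) \<longrightarrow> v \<in> D \<and> L2_eq \<Omega> (T v) w)"

definition eigenpair ::
  "(real^'n) set \<Rightarrow> (real^'n \<Rightarrow> real^'n^'n) \<Rightarrow> (real^'n \<Rightarrow> real) \<Rightarrow>
   real \<Rightarrow> (real^'n \<Rightarrow> real) \<Rightarrow> bool" where
  "eigenpair \<Omega> M a0 \<mu> e \<longleftrightarrow> e \<in> op_dom \<Omega> \<and> \<not> L2_eq \<Omega> e (\<lambda>x. 0) \<and>
     L2_eq \<Omega> (ell_op \<Omega> M a0 e) (\<lambda>x. \<mu> * e x)"

definition principal_eigenvalue ::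
  "(real^'n) set \<Rightarrow> (real^'n \<Rightarrow> real^'n^'n) \<Rightarrow> (real^'n \<Rightarrow> real) \<Rightarrow> real \<Rightarrow> bool" where
  "principal_eigenvalue \<Omega> M a0 \<mu>1 \<longleftrightarrow>
     (\<exists>e. eigenpair \<Omega> M a0 \<mu>1 e) \<and> (\<forall>\<mu> e. eigenpair \<Omega> M a0 \<mu> e \<longrightarrow> \<mu>1 \<le> \<mu>)"


section \<open>Powers of the operator\<close>

definition eigenbasis ::
  "(real^'n) set \<Rightarrow> (real^'n \<Rightarrow> real^'n^'n) \<Rightarrow> (real^'n \<Rightarrow> real) \<Rightarrow>
   (nat \<Rightarrow> real) \<Rightarrow> (nat \<Rightarrow> real^'n \<Rightarrow> real) \<Rightarrow> bool" where
  "eigenbasis \<Omega> M a0 \<mu> e \<longleftrightarrow>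
     (\<forall>m. eigenpair \<Omega> M a0 (\<mu> m) (e m)) \<and>
     (\<forall>m m'. L2_inner \<Omega> (e m) (e m') = (if m = m' then 1 else 0)) \<and>
     (\<forall>v\<in>L2 \<Omega>. (\<forall>m. L2_inner \<Omega> v (e m) = 0) \<longrightarrow> L2_eq \<Omega> v (\<lambda>x. 0))"

text \<open>\<open>A\<^sup>s v = w\<close>: the operator has compact inverse, hence an orthonormal basis of
  eigenfunctions \<open>e\<^sub>m\<close> with eigenvalues \<open>\<mu>\<^sub>m > 0\<close>, and
  \<open>A\<^sup>s v = \<Sum>\<^sub>m \<mu>\<^sub>m\<^sup>s (v, e\<^sub>m) e\<^sub>m\<close> whenever the series converges in \<open>L\<^sup>2(\<Omega>)\<close>. Neither the
  convergence nor the sum depends on the chosen basis.\<close>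

definition is_op_pow ::
  "(real^'n) set \<Rightarrow> (real^'n \<Rightarrow> real^'n^'n) \<Rightarrow> (real^'n \<Rightarrow> real) \<Rightarrow> real \<Rightarrow>
   (real^'n \<Rightarrow> real) \<Rightarrow> (real^'n \<Rightarrow> real) \<Rightarrow> bool" where
  "is_op_pow \<Omega> M a0 s v w \<longleftrightarrow> v \<in> L2 \<Omega> \<and> w \<in> L2 \<Omega> \<and>
     (\<exists>\<mu> e. eigenbasis \<Omega> M a0 \<mu> e \<and>
        (\<lambda>N. L2_norm \<Omega> (\<lambda>x. w x - (\<Sum>m<N. \<mu> m powr s * L2_inner \<Omega> v (e m) * e m x)))
          \<longlonglongrightarrow> 0)"

definition pow_dom ::
  "(real^'n) set \<Rightarrow> (real^'n \<Rightarrow> real^'n^'n) \<Rightarrow> (real^'n \<Rightarrow> real) \<Rightarrow> real \<Rightarrow>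
   (real^'n \<Rightarrow> real) set" where
  "pow_dom \<Omega> M a0 s = {v. \<exists>w. is_op_pow \<Omega> M a0 s v w}"

definition op_pow ::
  "(real^'n) set \<Rightarrow> (real^'n \<Rightarrow> real^'n^'n) \<Rightarrow> (real^'n \<Rightarrow> real) \<Rightarrow> real \<Rightarrow>
   (real^'n \<Rightarrow> real) \<Rightarrow> real^'n \<Rightarrow> real" where
  "op_pow \<Omega> M a0 s v = (SOME w. is_op_pow \<Omega> M a0 s v w)"

text \<open>The norm of \<open>T v\<close>, with the usual convention that it is \<open>\<infinity>\<close> if \<open>v\<close> is outside the
  domain \<open>D\<close> of \<open>T\<close>.\<close>

definition ext_norm ::
  "(real^'n) set \<Rightarrow> (real^'n \<Rightarrow> real) set \<Rightarrow> ((real^'n \<Rightarrow> real) \<Rightarrow> real^'n \<Rightarrow> real) \<Rightarrow>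
   (real^'n \<Rightarrow> real) \<Rightarrow> ennreal" where
  "ext_norm \<Omega> D T v = (if v \<in> D then ennreal (L2_norm \<Omega> (T v)) else \<infinity>)"


section \<open>Time derivatives and the damped wave equation\<close>

text \<open>Derivatives of \<open>[0,\<infinity>) \<rightarrow> L\<^sup>2(\<Omega>)\<close> in the norm of \<open>L\<^sup>2(\<Omega>)\<close>, one-sided at \<open>0\<close>.\<close>

definition has_time_deriv ::
  "(real^'n) set \<Rightarrow> (real \<Rightarrow> real^'n \<Rightarrow> real) \<Rightarrow> (real^'n \<Rightarrow> real) \<Rightarrow> real \<Rightarrow> bool" where
  "has_time_deriv \<Omega> u v t \<longleftrightarrow> (\<forall>s\<ge>0. u s \<in> L2 \<Omega>) \<and> v \<in> L2 \<Omega> \<and>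
     ((\<lambda>s. L2_norm \<Omega> (\<lambda>x. (u s x - u t x) / (s - t) - v x)) \<longlongrightarrow> 0) (at t within {0..})"

definition time_deriv ::
  "(real^'n) set \<Rightarrow> (real \<Rightarrow> real^'n \<Rightarrow> real) \<Rightarrow> real \<Rightarrow> real^'n \<Rightarrow> real" where
  "time_deriv \<Omega> u t = (SOME v. has_time_deriv \<Omega> u v t)"

definition time_deriv_n ::
  "(real^'n) set \<Rightarrow> nat \<Rightarrow> (real \<Rightarrow> real^'n \<Rightarrow> real) \<Rightarrow> real \<Rightarrow> real^'n \<Rightarrow> real" where
  "time_deriv_n \<Omega> j u = (time_deriv \<Omega> ^^ j) u"

definition time_differentiable_n ::
  "(real^'n) set \<Rightarrow> nat \<Rightarrow> (real \<Rightarrow> real^'n \<Rightarrow> real) \<Rightarrow> bool" where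
  "time_differentiable_n \<Omega> j u \<longleftrightarrow>
     (\<forall>i<j. \<forall>t\<ge>0. \<exists>v. has_time_deriv \<Omega> (time_deriv_n \<Omega> i u) v t)"

definition damped_wave_solution ::
  "(real^'n) set \<Rightarrow> (real^'n \<Rightarrow> real^'n^'n) \<Rightarrow> (real^'n \<Rightarrow> real) \<Rightarrow> real \<Rightarrow>
   (real^'n \<Rightarrow> real) \<Rightarrow> (real^'n \<Rightarrow> real) \<Rightarrow> (real \<Rightarrow> real^'n \<Rightarrow> real) \<Rightarrow> bool" where
  "damped_wave_solution \<Omega> M a0 \<alpha> u0 u1 u \<longleftrightarrow>
     time_differentiable_n \<Omega> 1 u \<and>
     (\<forall>t>0. (\<exists>v. has_time_deriv \<Omega> (time_deriv_n \<Omega> 1 u) v t) \<and> u t \<in> op_dom \<Omega> \<and>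
        L2_eq \<Omega> (\<lambda>x. time_deriv_n \<Omega> 2 u t x + \<alpha> * time_deriv_n \<Omega> 1 u t x
                     + ell_op \<Omega> M a0 (u t) x) (\<lambda>x. 0)) \<and>
     L2_eq \<Omega> (u 0) u0 \<and> L2_eq \<Omega> (time_deriv_n \<Omega> 1 u 0) u1"


section \<open>Energies\<close>

definition energy_A ::
  "(real^'n) set \<Rightarrow> (real^'n \<Rightarrow> real^'n^'n) \<Rightarrow> (real^'n \<Rightarrow> real) \<Rightarrow> nat \<Rightarrow>
   (real \<Rightarrow> real^'n \<Rightarrow> real) \<Rightarrow> real \<Rightarrow> ennreal" where
  "energy_A \<Omega> M a0 j u t = (1/2) *
     ((ext_norm \<Omega> (pow_dom \<Omega> M a0 (1/2)) (op_pow \<Omega> M a0 (1/2)) (time_deriv_n \<Omega> j u t))\<^sup>2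
      + (ext_norm \<Omega> (op_dom \<Omega>) (ell_op \<Omega> M a0) (time_deriv_n \<Omega> (j - 1) u t))\<^sup>2)"

definition energy_Ak ::
  "(real^'n) set \<Rightarrow> (real^'n \<Rightarrow> real^'n^'n) \<Rightarrow> (real^'n \<Rightarrow> real) \<Rightarrow> real \<Rightarrow> nat \<Rightarrow>
   (real \<Rightarrow> real^'n \<Rightarrow> real) \<Rightarrow> real \<Rightarrow> ennreal" where
  "energy_Ak \<Omega> M a0 k j u t = (1/2) *
     ((ext_norm \<Omega> (pow_dom \<Omega> M a0 (k - 1/2)) (op_pow \<Omega> M a0 (k - 1/2))
         (time_deriv_n \<Omega> j u t))\<^sup>2
      + (ext_norm \<Omega> (pow_dom \<Omega> M a0 k) (op_pow \<Omega> M a0 k) (time_deriv_n \<Omega> (j - 1) u t))\<^sup>2)"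

end

theory Submission
  imports Defs
begin

text \<open>In an orthonormal eigenbasis \<open>e\<^sub>m\<close> of \<open>A\<close>, the coefficients \<open>x = (u\<^sup>(\<^sup>j\<^sup>-\<^sup>1\<^sup>), e\<^sub>m)\<close> and
  \<open>y = (u\<^sup>(\<^sup>j\<^sup>), e\<^sub>m)\<close> satisfy \<open>x' = y\<close> and \<open>y' = - \<alpha> y - \<mu>\<^sub>m x\<close> up to \<open>t = 0\<close>, and by Parseval both
  energies are sums over \<open>m\<close> of \<open>\<mu>\<^sub>m\<^sup>2\<^sup>k\<^sup>-\<^sup>1 (y\<^sup>2 + \<mu>\<^sub>m x\<^sup>2) / 2\<close>, with \<open>k = 1\<close> in (i). Thus it suffices to treat a
  single mode. There \<open>e\<^sup>2\<^sup>\<delta>\<^sup>t V\<close> is nonincreasing for the modified energy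
  \<open>V = (y\<^sup>2 + \<mu>\<^sub>m x\<^sup>2) / 2 + 3/2 \<delta> x y + 3/4 \<delta> \<alpha> x\<^sup>2\<close>, which lies between \<open>5/16\<close> and \<open>15/16\<close> times
  \<open>y\<^sup>2 + \<mu>\<^sub>m x\<^sup>2\<close>; the ratio of these bounds is the constant \<open>3\<close>. If an energy is infinite at \<open>t = 0\<close>
  nothing is claimed, so the regularity of \<open>u\<close> at later times comes out of the same estimate.\<close>

section \<open>Completeness of \<open>L\<^sup>2(\<Omega>)\<close>\<close>

lemma L2_intro: "f \<in> borel_measurable (lebesgue_on \<Omega>) \<Longrightarrow> integrable (lebesgue_on \<Omega>) (\<lambda>x. (f x)\<^sup>2) \<Longrightarrow> f \<in> L2 \<Omega>"
  by (simp add: L2_def)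

lemma L2_measurable: "f \<in> L2 \<Omega> \<Longrightarrow> f \<in> borel_measurable (lebesgue_on \<Omega>)"
  by (simp add: L2_def)

lemma L2_integrable_mult:
  assumes f: "f \<in> L2 \<Omega>" and g: "g \<in> L2 \<Omega>"
  shows "integrable (lebesgue_on \<Omega>) (\<lambda>x. f x * g x)"
proof (rule Bochner_Integration.integrable_bound)
  show "integrable (lebesgue_on \<Omega>) (\<lambda>x. (f x)\<^sup>2 + (g x)\<^sup>2)"
    using f g by (simp add: L2_def)
  show "(\<lambda>x. f x * g x) \<in> borel_measurable (lebesgue_on \<Omega>)"
    using f g by (intro borel_measurable_times L2_measurable)
  have "\<bar>a * b\<bar> \<le> a\<^sup>2 + b\<^sup>2" for a b :: real
  proof -
    have "2 * \<bar>a\<bar> * \<bar>b\<bar> \<le> \<bar>a\<bar>\<^sup>2 + \<bar>b\<bar>\<^sup>2" by (rule sum_squares_bound)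
    moreover have "0 \<le> \<bar>a\<bar> * \<bar>b\<bar>" by simp
    ultimately show ?thesis unfolding abs_mult power2_abs by linarith
  qed
  then show "AE x in lebesgue_on \<Omega>. norm (f x * g x) \<le> norm ((f x)\<^sup>2 + (g x)\<^sup>2)"
    by simp
qed

lemma L2_scale: "f \<in> L2 \<Omega> \<Longrightarrow> (\<lambda>x. c * f x) \<in> L2 \<Omega>"
  by (auto simp: L2_def power_mult_distrib)

lemma L2_add:
  assumes f: "f \<in> L2 \<Omega>" and g: "g \<in> L2 \<Omega>"
  shows "(\<lambda>x. f x + g x) \<in> L2 \<Omega>"
proof (rule L2_intro)
  show "(\<lambda>x. f x + g x) \<in> borel_measurable (lebesgue_on \<Omega>)"
    using f g by (intro borel_measurable_add L2_measurable)
  show "integrable (lebesgue_on \<Omega>) (\<lambda>x. (f x + g x)\<^sup>2)"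
    unfolding power2_sum using f g L2_integrable_mult[OF f g]
    by (auto simp: L2_def mult.assoc intro!: Bochner_Integration.integrable_add)
qed

lemma L2_diff:
  assumes "f \<in> L2 \<Omega>" and "g \<in> L2 \<Omega>"
  shows "(\<lambda>x. f x - g x) \<in> L2 \<Omega>"
  using L2_add[OF assms(1) L2_scale[OF assms(2), of "-1"]] by simp

lemma L2_zero: "(\<lambda>x. 0) \<in> L2 \<Omega>"
  by (simp add: L2_def)

lemma L2_sum: "(\<And>i. i \<in> I \<Longrightarrow> f i \<in> L2 \<Omega>) \<Longrightarrow> (\<lambda>x. \<Sum>i\<in>I. f i x) \<in> L2 \<Omega>"
  by (induction I rule: infinite_finite_induct) (auto simp: L2_zero intro!: L2_add)

lemma L2_inner_commute: "L2_inner \<Omega> f g = L2_inner \<Omega> g f"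
  by (simp add: L2_inner_def mult.commute)

lemma L2_inner_scale: "L2_inner \<Omega> (\<lambda>x. c * f x) g = c * L2_inner \<Omega> f g"
  by (simp add: L2_inner_def mult.assoc)

lemma L2_inner_add:
  assumes "f \<in> L2 \<Omega>" "g \<in> L2 \<Omega>" "h \<in> L2 \<Omega>"
  shows "L2_inner \<Omega> (\<lambda>x. f x + g x) h = L2_inner \<Omega> f h + L2_inner \<Omega> g h"
  using assms by (simp add: L2_inner_def distrib_right L2_integrable_mult)

lemma L2_inner_diff:
  assumes "f \<in> L2 \<Omega>" "g \<in> L2 \<Omega>" "h \<in> L2 \<Omega>"
  shows "L2_inner \<Omega> (\<lambda>x. f x - g x) h = L2_inner \<Omega> f h - L2_inner \<Omega> g h"
  using assms by (simp add: L2_inner_def left_diff_distrib L2_integrable_mult)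

lemma L2_inner_sum:
  assumes "\<And>i. i \<in> I \<Longrightarrow> f i \<in> L2 \<Omega>" "h \<in> L2 \<Omega>"
  shows "L2_inner \<Omega> (\<lambda>x. \<Sum>i\<in>I. f i x) h = (\<Sum>i\<in>I. L2_inner \<Omega> (f i) h)"
  using assms by (simp add: L2_inner_def sum_distrib_right L2_integrable_mult)

lemma L2_inner_zero [simp]: "L2_inner \<Omega> (\<lambda>x. 0) h = 0"
  by (simp add: L2_inner_def)

lemma L2_eq_inner:
  assumes "L2_eq \<Omega> f g" "f \<in> L2 \<Omega>" "g \<in> L2 \<Omega>" "h \<in> L2 \<Omega>"
  shows "L2_inner \<Omega> f h = L2_inner \<Omega> g h"
  unfolding L2_inner_def
  using assms by (intro integral_cong_AE) (auto simp: L2_eq_def L2_def)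

lemma L2_inner_self_nonneg [simp]: "0 \<le> L2_inner \<Omega> f f"
  by (simp add: L2_inner_def)

lemma L2_norm_nonneg [simp]: "0 \<le> L2_norm \<Omega> f"
  by (simp add: L2_norm_def)

lemma L2_norm_square: "(L2_norm \<Omega> f)\<^sup>2 = L2_inner \<Omega> f f"
  by (simp add: L2_norm_def)

lemma L2_Cauchy_Schwarz:
  assumes f: "f \<in> L2 \<Omega>" and g: "g \<in> L2 \<Omega>"
  shows "\<bar>L2_inner \<Omega> f g\<bar> \<le> L2_norm \<Omega> f * L2_norm \<Omega> g"
proof -
  let ?a = "L2_inner \<Omega> f f" and ?b = "L2_inner \<Omega> f g" and ?c = "L2_inner \<Omega> g g"
  \<comment> \<open>The expression is the squared norm of \<open>f - t g\<close>; Cauchy-Schwarz is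
    its nonnegativity at one well-chosen \<open>t\<close>.\<close>
  have q: "0 \<le> ?a - 2 * t * ?b + t\<^sup>2 * ?c" for t
  proof -
    define h where "h = (\<lambda>x. t * g x)"
    have h: "h \<in> L2 \<Omega>" unfolding h_def by (rule L2_scale[OF g])
    have fh: "(\<lambda>x. f x - h x) \<in> L2 \<Omega>" by (rule L2_diff[OF f h])
    have "0 \<le> L2_inner \<Omega> (\<lambda>x. f x - h x) (\<lambda>x. f x - h x)" by simp
    also have "\<dots> = L2_inner \<Omega> f (\<lambda>x. f x - h x) - L2_inner \<Omega> h (\<lambda>x. f x - h x)"
      by (rule L2_inner_diff[OF f h fh])
    also have "\<dots> = ?a - 2 * L2_inner \<Omega> h f + L2_inner \<Omega> h h"
      by (simp add: L2_inner_commute[of \<Omega> _ "\<lambda>x. f x - h x"] L2_inner_diff[OF f h]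
          f h L2_inner_commute[of \<Omega> f h])
    also have "L2_inner \<Omega> h f = t * ?b"
      unfolding h_def L2_inner_scale by (simp add: L2_inner_commute)
    also have "L2_inner \<Omega> h h = t\<^sup>2 * ?c"
      unfolding h_def L2_inner_scale L2_inner_commute[of \<Omega> g "\<lambda>x. t * g x"]
      by (simp add: power2_eq_square)
    finally show ?thesis by simp
  qed
  have "?b\<^sup>2 \<le> ?a * ?c"
  proof (cases "?c = 0")
    case True
    have "?b = 0"
    proof (rule ccontr)
      assume "?b \<noteq> 0"
      \<comment> \<open>With \<open>?c = 0\<close> the expression is affine in \<open>t\<close>, and
        this \<open>t\<close> gives it the value \<open>-1\<close>.\<close>
      then show False using q[of "(?a + 1) / (2 * ?b)"] True by simp
    qed
    then show ?thesis using True by simp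
  next
    case False
    then have c: "?c > 0" using L2_inner_self_nonneg[of \<Omega> g] by linarith
    have "0 \<le> (?a - 2 * (?b / ?c) * ?b + (?b / ?c)\<^sup>2 * ?c) * ?c"
      using c by (intro mult_nonneg_nonneg q less_imp_le)
    also have "\<dots> = ?a * ?c - ?b\<^sup>2"
      using c by (simp add: field_simps power2_eq_square)
    finally show ?thesis by simp
  qed
  then have "sqrt (?b\<^sup>2) \<le> sqrt (?a * ?c)" by (rule real_sqrt_le_mono)
  then show ?thesis by (simp add: L2_norm_def real_sqrt_mult)
qed

text \<open>Cauchy-Schwarz applied to \<open>w - S n\<close>. The filter is arbitrary because both
  partial sums of series and difference quotients in time have to be treated.\<close>

lemma L2_inner_tendsto:
  assumes S: "\<forall>\<^sub>F n in F. S n \<in> L2 \<Omega>" and w: "w \<in> L2 \<Omega>" and g: "g \<in> L2 \<Omega>"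
    and lim: "((\<lambda>n. L2_norm \<Omega> (\<lambda>x. w x - S n x)) \<longlongrightarrow> 0) F"
  shows "((\<lambda>n. L2_inner \<Omega> (S n) g) \<longlongrightarrow> L2_inner \<Omega> w g) F"
proof -
  have "((\<lambda>n. L2_inner \<Omega> w g - L2_inner \<Omega> (S n) g) \<longlongrightarrow> 0) F"
  proof (rule Lim_null_comparison)
    show "\<forall>\<^sub>F n in F. norm (L2_inner \<Omega> w g - L2_inner \<Omega> (S n) g)
            \<le> L2_norm \<Omega> (\<lambda>x. w x - S n x) * L2_norm \<Omega> g"
      using S
    proof eventually_elim
      case (elim n)
      show ?case
        using L2_Cauchy_Schwarz[OF L2_diff[OF w elim] g] by (simp add: L2_inner_diff w elim g)
    qed
    show "((\<lambda>n. L2_norm \<Omega> (\<lambda>x. w x - S n x) * L2_norm \<Omega> g) \<longlongrightarrow> 0) F"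
      using tendsto_mult[OF lim tendsto_const] by simp
  qed
  from tendsto_diff[OF tendsto_const[of "L2_inner \<Omega> w g"] this] show ?thesis by simp
qed

section \<open>Integrals of squares, and completeness by way of Fatou's lemma\<close>

lemma L2_integral_square: "(LINT x|lebesgue_on \<Omega>. (f x)\<^sup>2) = (L2_norm \<Omega> f)\<^sup>2"
  unfolding L2_norm_square L2_inner_def by (simp add: power2_eq_square)

lemma L2_nn_integral_square:
  assumes "f \<in> L2 \<Omega>"
  shows "(\<integral>\<^sup>+x. ennreal ((f x)\<^sup>2) \<partial>lebesgue_on \<Omega>) = ennreal ((L2_norm \<Omega> f)\<^sup>2)"
  unfolding L2_integral_square[symmetric]
  using assms by (intro nn_integral_eq_integral) (auto simp: L2_def)

text \<open>Meant for a pointwise limit whose integrability is not yet known: its nonnegative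
  integral always makes sense, and this is what Fatou's lemma bounds.\<close>

lemma L2_of_nn_integral_bound:
  assumes f: "f \<in> borel_measurable (lebesgue_on \<Omega>)" and c: "0 \<le> c"
    and le: "(\<integral>\<^sup>+x. ennreal ((f x)\<^sup>2) \<partial>lebesgue_on \<Omega>) \<le> ennreal (c\<^sup>2)"
  shows "f \<in> L2 \<Omega>" "L2_norm \<Omega> f \<le> c"
proof -
  have "(\<integral>\<^sup>+x. ennreal ((f x)\<^sup>2) \<partial>lebesgue_on \<Omega>) < \<infinity>"
    using le by (rule le_less_trans) simp
  then have "integrable (lebesgue_on \<Omega>) (\<lambda>x. (f x)\<^sup>2)"
    using f by (intro integrableI_nonneg borel_measurable_power) auto
  with f show L2: "f \<in> L2 \<Omega>" by (rule L2_intro)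
  have "(L2_norm \<Omega> f)\<^sup>2 \<le> c\<^sup>2"
    using le unfolding L2_nn_integral_square[OF L2] by (simp add: ennreal_le_iff)
  then show "L2_norm \<Omega> f \<le> c" using c by (rule power2_le_imp_le)
qed

text \<open>A rapidly Cauchy subsequence converges almost everywhere; Fatou's lemma then makes its
  pointwise limit the limit in norm of the whole sequence.\<close>

lemma L2_complete:
  assumes S: "\<And>n. S n \<in> L2 \<Omega>"
    and Cauchy: "\<And>\<epsilon>. \<epsilon> > 0 \<Longrightarrow> \<exists>N. \<forall>m\<ge>N. \<forall>n\<ge>N. L2_norm \<Omega> (\<lambda>x. S m x - S n x) \<le> \<epsilon>"
  shows "\<exists>w\<in>L2 \<Omega>. (\<lambda>n. L2_norm \<Omega> (\<lambda>x. w x - S n x)) \<longlonglongrightarrow> 0"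
proof -
  let ?M = "lebesgue_on \<Omega>"
  have "\<exists>N. \<forall>m\<ge>N. \<forall>n\<ge>N. L2_norm \<Omega> (\<lambda>x. S m x - S n x) \<le> (1/2)^k" for k :: nat
    by (rule Cauchy) simp
  then obtain N where N: "L2_norm \<Omega> (\<lambda>x. S m x - S n x) \<le> (1/2)^k"
    if "m \<ge> N k" "n \<ge> N k" for k m n
    by metis
  \<comment> \<open>Adding up the thresholds gives \<open>r l \<ge> N k\<close> for all
    \<open>l \<ge> k\<close>, even if \<open>N\<close> is not monotone.\<close>
  define r where "r k = k + (\<Sum>i\<le>k. N i)" for k
  have r_ge: "r l \<ge> N k" if "l \<ge> k" for k l
  proof -
    have "N k \<le> (\<Sum>i\<le>l. N i)" using that by (intro member_le_sum) auto
    then show ?thesis by (simp add: r_def)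
  qed
  have [measurable]: "S n \<in> borel_measurable ?M" for n by (rule L2_measurable[OF S])
  define g where "g k x = S (r (Suc k)) x - S (r k) x" for k x
  have g_L2: "g k \<in> L2 \<Omega>" for k
    unfolding g_def by (intro L2_diff S)
  have [measurable]: "g k \<in> borel_measurable ?M" for k by (rule L2_measurable[OF g_L2])
  have g_norm: "L2_norm \<Omega> (g k) \<le> (1/2)^k" for k
    unfolding g_def by (rule N) (auto intro: r_ge)
  \<comment> \<open>The weight \<open>2\<^sup>k\<close> makes the almost everywhere finite sum of squares control \<open>\<Sum>\<^sub>k \<bar>g\<^sub>k\<bar>\<close>.\<close>
  have "(\<integral>\<^sup>+x. (\<Sum>k. ennreal (2^k * (g k x)\<^sup>2)) \<partial>?M) = (\<Sum>k. \<integral>\<^sup>+x. ennreal (2^k * (g k x)\<^sup>2) \<partial>?M)"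
    by (intro nn_integral_suminf) simp
  also have "\<dots> \<le> (\<Sum>k. ennreal ((1/2)^k))"
  proof (intro suminf_le)
    fix k
    have "(\<integral>\<^sup>+x. ennreal (2^k * (g k x)\<^sup>2) \<partial>?M) = ennreal (2^k) * (\<integral>\<^sup>+x. ennreal ((g k x)\<^sup>2) \<partial>?M)"
      by (subst nn_integral_cmult[symmetric]) (auto simp: ennreal_mult)
    also have "\<dots> = ennreal (2^k * (L2_norm \<Omega> (g k))\<^sup>2)"
      by (simp add: L2_nn_integral_square[OF g_L2] ennreal_mult)
    also have "\<dots> \<le> ennreal ((1/2)^k)"
    proof (rule ennreal_leI)
      have "2^k * (L2_norm \<Omega> (g k))\<^sup>2 \<le> 2^k * (((1/2)^k)\<^sup>2)"
        by (intro mult_left_mono power_mono g_norm) auto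
      also have "\<dots> = (1/2)^k"
        by (simp add: power2_eq_square power_one_over)
      finally show "2^k * (L2_norm \<Omega> (g k))\<^sup>2 \<le> (1/2)^k" .
    qed
    finally show "(\<integral>\<^sup>+x. ennreal (2^k * (g k x)\<^sup>2) \<partial>?M) \<le> ennreal ((1/2)^k)" .
  qed auto
  also have "\<dots> < \<infinity>"
    by (subst suminf_ennreal2) (auto simp: summable_geometric)
  finally have "AE x in ?M. (\<Sum>k. ennreal (2^k * (g k x)\<^sup>2)) \<noteq> \<infinity>"
    by (intro nn_integral_PInf_AE) auto
  then have conv: "AE x in ?M. convergent (\<lambda>k. S (r k) x)"
  proof (rule eventually_mono)
    fix x assume "(\<Sum>k. ennreal (2^k * (g k x)\<^sup>2)) \<noteq> \<infinity>"
    then have "summable (\<lambda>k. 2^k * (g k x)\<^sup>2)"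
      by (intro summable_suminf_not_top) auto
    then have "summable (\<lambda>k. 2^k * (g k x)\<^sup>2 + (1/2)^k)"
      by (intro summable_add summable_geometric) auto
    then have "summable (\<lambda>k. g k x)"
    proof (rule summable_comparison_test'[where N = 0])
      fix k :: nat
      define p where "p = (2::real)^k"
      have p: "p > 0" by (simp add: p_def)
      \<comment> \<open>Completing the square: after division by \<open>p\<close> it bounds
        \<open>\<bar>g k x\<bar>\<close> by \<open>p * (g k x)\<^sup>2 + 1 / p\<close>, a sum of two
        summable terms.\<close>
      have "0 \<le> (p * \<bar>g k x\<bar> - 1)\<^sup>2" by simp
      then have "2 * p * \<bar>g k x\<bar> \<le> p\<^sup>2 * (g k x)\<^sup>2 + 1"
        by (simp add: power2_diff power_mult_distrib)
      moreover have "0 \<le> p * \<bar>g k x\<bar>" using p by simp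
      ultimately have "p * \<bar>g k x\<bar> \<le> p\<^sup>2 * (g k x)\<^sup>2 + 1" by linarith
      also have "\<dots> = p * (p * (g k x)\<^sup>2 + 1 / p)"
        using p by (simp add: field_simps power2_eq_square)
      finally show "norm (g k x) \<le> 2^k * (g k x)\<^sup>2 + (1/2)^k"
        using p by (simp add: p_def power_one_over)
    qed
    then have "convergent (\<lambda>n. \<Sum>k<n. g k x)" by (simp add: summable_iff_convergent)
    also have "(\<lambda>n. \<Sum>k<n. g k x) = (\<lambda>n. S (r n) x - S (r 0) x)"
      unfolding g_def by (rule ext) (rule sum_lessThan_telescope)
    finally have "convergent (\<lambda>n. S (r n) x - S (r 0) x + S (r 0) x)"
      by (intro convergent_add convergent_const)
    then show "convergent (\<lambda>k. S (r k) x)" by simp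
  qed
  define w where "w x = lim (\<lambda>k. S (r k) x)" for x
  have w_meas [measurable]: "w \<in> borel_measurable ?M"
    unfolding w_def by measurable
  \<comment> \<open>Fatou's lemma in the index \<open>k\<close>: for \<open>k \<ge> i\<close> both
    \<open>r k\<close> and \<open>n\<close> are at least \<open>N i\<close>, and the bound
    \<open>(1/2)^i\<close> survives the passage to \<open>w\<close>.\<close>
  have close: "(\<lambda>x. w x - S n x) \<in> L2 \<Omega> \<and> L2_norm \<Omega> (\<lambda>x. w x - S n x) \<le> (1/2)^i"
    if n: "n \<ge> N i" for n i
  proof -
    have "(\<integral>\<^sup>+x. ennreal ((w x - S n x)\<^sup>2) \<partial>?M)
        = (\<integral>\<^sup>+x. liminf (\<lambda>k. ennreal ((S (r k) x - S n x)\<^sup>2)) \<partial>?M)"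
      using conv
    proof (intro nn_integral_cong_AE, elim eventually_mono)
      fix x assume "convergent (\<lambda>k. S (r k) x)"
      then have "(\<lambda>k. S (r k) x) \<longlonglongrightarrow> w x"
        unfolding w_def by (simp add: convergent_LIMSEQ_iff)
      then have "(\<lambda>k. ennreal ((S (r k) x - S n x)\<^sup>2)) \<longlonglongrightarrow> ennreal ((w x - S n x)\<^sup>2)"
        by (intro tendsto_intros)
      then show "ennreal ((w x - S n x)\<^sup>2) = liminf (\<lambda>k. ennreal ((S (r k) x - S n x)\<^sup>2))"
        by (intro lim_imp_Liminf[symmetric]) auto
    qed
    also have "\<dots> \<le> liminf (\<lambda>k. \<integral>\<^sup>+x. ennreal ((S (r k) x - S n x)\<^sup>2) \<partial>?M)"
      by (intro nn_integral_liminf) simp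
    also have "\<dots> = liminf (\<lambda>k. ennreal ((L2_norm \<Omega> (\<lambda>x. S (r k) x - S n x))\<^sup>2))"
      by (simp add: L2_nn_integral_square L2_diff S)
    also have "\<dots> \<le> liminf (\<lambda>k. ennreal (((1/2)^i)\<^sup>2))"
    proof (rule Liminf_mono)
      show "\<forall>\<^sub>F k in sequentially. ennreal ((L2_norm \<Omega> (\<lambda>x. S (r k) x - S n x))\<^sup>2)
              \<le> ennreal (((1/2)^i)\<^sup>2)"
        using eventually_ge_at_top[of i]
        by eventually_elim (auto intro!: ennreal_leI power_mono N n r_ge)
    qed
    also have "\<dots> = ennreal (((1/2)^i)\<^sup>2)" by (simp add: Liminf_const)
    finally show ?thesis
      by (intro conjI L2_of_nn_integral_bound[where c = "(1/2)^i"]) auto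
  qed
  have "(\<lambda>x. (w x - S (N 0) x) + S (N 0) x) \<in> L2 \<Omega>"
    using close[of 0 "N 0"] S by (intro L2_add) auto
  then have w: "w \<in> L2 \<Omega>" by simp
  have "(\<lambda>n. L2_norm \<Omega> (\<lambda>x. w x - S n x)) \<longlonglongrightarrow> 0"
  proof (rule LIMSEQ_I)
    fix \<epsilon> :: real assume "\<epsilon> > 0"
    then obtain i where "(1/2)^i < \<epsilon>" using real_arch_pow_inv[of \<epsilon> "1/2"] by auto
    then have "norm (L2_norm \<Omega> (\<lambda>x. w x - S n x) - 0) < \<epsilon>" if "n \<ge> N i" for n
      using close[OF that] by simp
    then show "\<exists>n0. \<forall>n\<ge>n0. norm (L2_norm \<Omega> (\<lambda>x. w x - S n x) - 0) < \<epsilon>" by blast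
  qed
  with w show ?thesis by blast
qed

section \<open>Orthonormal expansions\<close>

lemma L2_norm_minus_commute: "L2_norm \<Omega> (\<lambda>x. f x - g x) = L2_norm \<Omega> (\<lambda>x. g x - f x)"
proof -
  have "(f x - g x) * (f x - g x) = (g x - f x) * (g x - f x)" for x by algebra
  then show ?thesis by (simp add: L2_norm_def L2_inner_def)
qed

definition L2_orthonormal :: "(real^'n) set \<Rightarrow> (nat \<Rightarrow> real^'n \<Rightarrow> real) \<Rightarrow> bool" where
  "L2_orthonormal \<Omega> e \<longleftrightarrow> (\<forall>m. e m \<in> L2 \<Omega>) \<and>
     (\<forall>m m'. L2_inner \<Omega> (e m) (e m') = (if m = m' then 1 else 0))"

lemma L2_orthonormal_combination:
  assumes e: "L2_orthonormal \<Omega> e" and I: "finite I"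
  shows "(\<lambda>x. \<Sum>m\<in>I. c m * e m x) \<in> L2 \<Omega>"
    and "g \<in> L2 \<Omega> \<Longrightarrow> L2_inner \<Omega> (\<lambda>x. \<Sum>m\<in>I. c m * e m x) g = (\<Sum>m\<in>I. c m * L2_inner \<Omega> (e m) g)"
    and "L2_inner \<Omega> (\<lambda>x. \<Sum>m\<in>I. c m * e m x) (e n) = (if n \<in> I then c n else 0)"
    and "(L2_norm \<Omega> (\<lambda>x. \<Sum>m\<in>I. c m * e m x))\<^sup>2 = (\<Sum>m\<in>I. (c m)\<^sup>2)"
proof -
  have eL: "e m \<in> L2 \<Omega>" for m using e by (simp add: L2_orthonormal_def)
  have ee: "L2_inner \<Omega> (e m) (e m') = (if m = m' then 1 else 0)" for m m'
    using e by (simp add: L2_orthonormal_def)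
  let ?S = "\<lambda>x. \<Sum>m\<in>I. c m * e m x"
  show S: "?S \<in> L2 \<Omega>" by (intro L2_sum L2_scale eL)
  show inner: "L2_inner \<Omega> ?S g = (\<Sum>m\<in>I. c m * L2_inner \<Omega> (e m) g)" if "g \<in> L2 \<Omega>" for g
    using that by (simp add: L2_inner_sum L2_scale eL L2_inner_scale)
  show coeff: "L2_inner \<Omega> ?S (e n) = (if n \<in> I then c n else 0)" for n
    using I by (simp add: inner eL ee if_distrib cong: if_cong)
  have "(L2_norm \<Omega> ?S)\<^sup>2 = (\<Sum>m\<in>I. c m * L2_inner \<Omega> ?S (e m))"
    unfolding L2_norm_square inner[OF S]
    by (intro sum.cong refl arg_cong2[where f = "(*)"] L2_inner_commute)
  also have "\<dots> = (\<Sum>m\<in>I. (c m)\<^sup>2)"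
    by (intro sum.cong) (simp_all add: coeff power2_eq_square)
  finally show "(L2_norm \<Omega> ?S)\<^sup>2 = (\<Sum>m\<in>I. (c m)\<^sup>2)" .
qed

text \<open>Partial sums differ by a block of orthogonal terms, so they inherit the Cauchy property
  from the series of squares. Completeness provides \<open>w\<close>, and continuity of the inner
  product gives its coefficients.\<close>

lemma L2_Riesz_Fischer:
  assumes e: "L2_orthonormal \<Omega> e" and c: "summable (\<lambda>m. (c m)\<^sup>2)"
  shows "\<exists>w\<in>L2 \<Omega>. (\<forall>n. L2_inner \<Omega> w (e n) = c n) \<and>
    (\<lambda>N. L2_norm \<Omega> (\<lambda>x. w x - (\<Sum>m<N. c m * e m x))) \<longlonglongrightarrow> 0"
proof -
  define S where "S N = (\<lambda>x. \<Sum>m<N. c m * e m x)" for N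
  have S: "S N \<in> L2 \<Omega>" for N
    unfolding S_def using e by (intro L2_orthonormal_combination) auto
  have norm_diff: "(L2_norm \<Omega> (\<lambda>x. S n x - S m x))\<^sup>2 = (\<Sum>k=m..<n. (c k)\<^sup>2)" if "m \<le> n" for m n
  proof -
    have "(\<lambda>x. S n x - S m x) = (\<lambda>x. \<Sum>k=m..<n. c k * e k x)"
      using that unfolding S_def
      by (intro ext) (metis lessThan_atLeast0 sum_diff_nat_ivl zero_le)
    then show ?thesis using L2_orthonormal_combination(4)[OF e] by simp
  qed
  have "\<exists>N. \<forall>m\<ge>N. \<forall>n\<ge>N. L2_norm \<Omega> (\<lambda>x. S m x - S n x) \<le> \<epsilon>" if "\<epsilon> > 0" for \<epsilon>
  proof -
    have "\<epsilon>\<^sup>2 > 0" using that by simp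
    then obtain N where N: "\<And>m n. m \<ge> N \<Longrightarrow> norm (\<Sum>k=m..<n. (c k)\<^sup>2) < \<epsilon>\<^sup>2"
      using c unfolding summable_Cauchy by blast
    have le: "L2_norm \<Omega> (\<lambda>x. S n x - S m x) \<le> \<epsilon>" if "m \<ge> N" "m \<le> n" for m n
    proof (rule power2_le_imp_le)
      show "(L2_norm \<Omega> (\<lambda>x. S n x - S m x))\<^sup>2 \<le> \<epsilon>\<^sup>2"
        using N[OF \<open>m \<ge> N\<close>, of n] by (simp add: norm_diff[OF \<open>m \<le> n\<close>])
    qed (use \<open>\<epsilon> > 0\<close> in simp)
    show ?thesis
    proof (intro exI allI impI)
      fix m n assume "m \<ge> N" "n \<ge> N"
      then show "L2_norm \<Omega> (\<lambda>x. S m x - S n x) \<le> \<epsilon>"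
        using le[of n m] le[of m n] L2_norm_minus_commute[of \<Omega> "S m" "S n"]
        by (cases "m \<le> n") auto
    qed
  qed
  from L2_complete[OF S this] obtain w where w: "w \<in> L2 \<Omega>"
    and lim: "(\<lambda>n. L2_norm \<Omega> (\<lambda>x. w x - S n x)) \<longlonglongrightarrow> 0" by blast
  have "L2_inner \<Omega> w (e n) = c n" for n
  proof (rule LIMSEQ_unique)
    show "(\<lambda>N. L2_inner \<Omega> (S N) (e n)) \<longlonglongrightarrow> L2_inner \<Omega> w (e n)"
      using e by (intro L2_inner_tendsto always_eventually allI S w lim) (simp add: L2_orthonormal_def)
    have "eventually (\<lambda>N. L2_inner \<Omega> (S N) (e n) = c n) sequentially"
      using eventually_gt_at_top[of n]
      by eventually_elim (simp add: S_def L2_orthonormal_combination(3)[OF e])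
    then show "(\<lambda>N. L2_inner \<Omega> (S N) (e n)) \<longlonglongrightarrow> c n" by (rule tendsto_eventually)
  qed
  with w lim show ?thesis by (auto simp: S_def)
qed

lemma L2_Bessel:
  assumes e: "L2_orthonormal \<Omega> e" and v: "v \<in> L2 \<Omega>"
  shows "summable (\<lambda>m. (L2_inner \<Omega> v (e m))\<^sup>2)"
proof (rule summableI_nonneg_bounded)
  fix N
  let ?c = "\<lambda>m. L2_inner \<Omega> v (e m)"
  define S where "S = (\<lambda>x. \<Sum>m<N. ?c m * e m x)"
  have S: "S \<in> L2 \<Omega>"
    unfolding S_def using e by (intro L2_orthonormal_combination) auto
  have SS: "L2_inner \<Omega> S S = (\<Sum>m<N. (?c m)\<^sup>2)"
    unfolding L2_norm_square[symmetric] S_def by (rule L2_orthonormal_combination(4)[OF e]) simp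
  have Sv: "L2_inner \<Omega> S v = (\<Sum>m<N. (?c m)\<^sup>2)"
    unfolding S_def L2_orthonormal_combination(2)[OF e finite_lessThan v]
    by (intro sum.cong refl) (simp add: L2_inner_commute power2_eq_square)
  \<comment> \<open>Since \<open>S\<close> has the same inner product with \<open>v\<close> as with
    itself, the squared norm of \<open>v - S\<close> is that of \<open>v\<close> minus the partial
    sum of squares.\<close>
  have "0 \<le> L2_inner \<Omega> (\<lambda>x. v x - S x) (\<lambda>x. v x - S x)" by simp
  also have "\<dots> = L2_inner \<Omega> (\<lambda>x. v x - S x) v - L2_inner \<Omega> (\<lambda>x. v x - S x) S"
    unfolding L2_inner_diff[OF v S L2_diff[OF v S]]
    by (simp only: L2_inner_commute[of \<Omega> v] L2_inner_commute[of \<Omega> S])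
  also have "\<dots> = L2_inner \<Omega> v v - L2_inner \<Omega> S v - (L2_inner \<Omega> v S - L2_inner \<Omega> S S)"
    by (simp only: L2_inner_diff[OF v S v] L2_inner_diff[OF v S S])
  finally show "(\<Sum>m<N. (?c m)\<^sup>2) \<le> L2_inner \<Omega> v v"
    unfolding L2_inner_commute[of \<Omega> v S] Sv SS by simp
qed simp

definition L2_basis :: "(real^'n) set \<Rightarrow> (nat \<Rightarrow> real^'n \<Rightarrow> real) \<Rightarrow> bool" where
  "L2_basis \<Omega> e \<longleftrightarrow> L2_orthonormal \<Omega> e \<and>
     (\<forall>v\<in>L2 \<Omega>. (\<forall>m. L2_inner \<Omega> v (e m) = 0) \<longrightarrow> L2_eq \<Omega> v (\<lambda>x. 0))"

text \<open>Riesz-Fischer produces a sum \<open>w\<close> of the series with the same coefficients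
  as \<open>v\<close>; then \<open>v - w\<close> is orthogonal to the basis, hence zero almost
  everywhere.\<close>

lemma L2_basis_expansion:
  assumes e: "L2_basis \<Omega> e" and v: "v \<in> L2 \<Omega>"
  shows "(\<lambda>N. L2_norm \<Omega> (\<lambda>x. v x - (\<Sum>m<N. L2_inner \<Omega> v (e m) * e m x))) \<longlonglongrightarrow> 0"
proof -
  have on: "L2_orthonormal \<Omega> e" using e by (simp add: L2_basis_def)
  then have eL: "e m \<in> L2 \<Omega>" for m by (simp add: L2_orthonormal_def)
  obtain w where w: "w \<in> L2 \<Omega>" and coeff: "\<And>n. L2_inner \<Omega> w (e n) = L2_inner \<Omega> v (e n)"
    and lim: "(\<lambda>N. L2_norm \<Omega> (\<lambda>x. w x - (\<Sum>m<N. L2_inner \<Omega> v (e m) * e m x))) \<longlonglongrightarrow> 0"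
    using L2_Riesz_Fischer[OF on L2_Bessel[OF on v]] by blast
  have "L2_inner \<Omega> (\<lambda>x. v x - w x) (e m) = 0" for m
    by (simp add: L2_inner_diff[OF v w eL] coeff)
  then have "L2_eq \<Omega> (\<lambda>x. v x - w x) (\<lambda>x. 0)"
    using e L2_diff[OF v w] unfolding L2_basis_def by blast
  then have ae: "AE x in lebesgue_on \<Omega>. v x = w x" by (simp add: L2_eq_def)
  have "L2_norm \<Omega> (\<lambda>x. v x - S x) = L2_norm \<Omega> (\<lambda>x. w x - S x)" if S: "S \<in> L2 \<Omega>" for S
  proof -
    have "(\<lambda>x. v x - S x) \<in> borel_measurable (lebesgue_on \<Omega>)"
      "(\<lambda>x. w x - S x) \<in> borel_measurable (lebesgue_on \<Omega>)"
      using L2_diff[OF v S] L2_diff[OF w S] by (auto intro: L2_measurable)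
    then show ?thesis
      unfolding L2_norm_def L2_inner_def using ae
      by (intro arg_cong[where f = sqrt] integral_cong_AE borel_measurable_times)
         (auto elim!: eventually_mono)
  qed
  then show ?thesis using lim by (simp add: L2_orthonormal_combination(1)[OF on])
qed

lemma L2_Parseval:
  assumes e: "L2_basis \<Omega> e" and v: "v \<in> L2 \<Omega>" and w: "w \<in> L2 \<Omega>"
  shows "(\<lambda>m. L2_inner \<Omega> v (e m) * L2_inner \<Omega> (e m) w) sums L2_inner \<Omega> v w"
proof -
  have on: "L2_orthonormal \<Omega> e" using e by (simp add: L2_basis_def)
  have "(\<lambda>N. L2_inner \<Omega> (\<lambda>x. \<Sum>m<N. L2_inner \<Omega> v (e m) * e m x) w) \<longlonglongrightarrow> L2_inner \<Omega> v w"
    by (intro L2_inner_tendsto always_eventually allI v w L2_basis_expansion e L2_orthonormal_combination(1)[OF on]) simp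
  then show ?thesis
    unfolding sums_def by (simp add: L2_orthonormal_combination(2)[OF on _ w])
qed

lemma L2_Parseval_norm:
  assumes "L2_basis \<Omega> e" and "v \<in> L2 \<Omega>"
  shows "(\<lambda>m. (L2_inner \<Omega> v (e m))\<^sup>2) sums (L2_norm \<Omega> v)\<^sup>2"
  using L2_Parseval[OF assms(1) assms(2) assms(2)]
  unfolding L2_norm_square by (simp add: power2_eq_square L2_inner_commute[of \<Omega> "e m" v for m])

section \<open>Spectral description of the operator and its powers\<close>

text \<open>The eigenbasis is a parameter, so that the locale can be instantiated a second time with
  the basis hidden in \<open>is_op_pow\<close>.\<close>

locale elliptic_eigenbasis =
  fixes \<Omega> :: "(real^'n) set" and M :: "real^'n \<Rightarrow> real^'n^'n" and a0 :: "real^'n \<Rightarrow> real"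
    and \<mu> :: "nat \<Rightarrow> real" and e :: "nat \<Rightarrow> real^'n \<Rightarrow> real"
  assumes self_adjoint: "self_adjoint_op \<Omega> (op_dom \<Omega>) (ell_op \<Omega> M a0)"
    and eigenbasis: "eigenbasis \<Omega> M a0 \<mu> e"
begin

abbreviation T :: "(real^'n \<Rightarrow> real) \<Rightarrow> real^'n \<Rightarrow> real" where
  "T \<equiv> ell_op \<Omega> M a0"

abbreviation coeff :: "(real^'n \<Rightarrow> real) \<Rightarrow> nat \<Rightarrow> real" where
  "coeff v m \<equiv> L2_inner \<Omega> v (e m)"

lemma op_dom_L2: "v \<in> op_dom \<Omega> \<Longrightarrow> v \<in> L2 \<Omega>" "v \<in> op_dom \<Omega> \<Longrightarrow> T v \<in> L2 \<Omega>"
  and op_symmetric: "v \<in> op_dom \<Omega> \<Longrightarrow> w \<in> op_dom \<Omega> \<Longrightarrow> L2_inner \<Omega> (T v) w = L2_inner \<Omega> v (T w)"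
  using self_adjoint unfolding self_adjoint_op_def by blast+

lemma op_dom_adjoint:
  assumes "v \<in> L2 \<Omega>" "w \<in> L2 \<Omega>" "\<And>\<phi>. \<phi> \<in> op_dom \<Omega> \<Longrightarrow> L2_inner \<Omega> (T \<phi>) v = L2_inner \<Omega> \<phi> w"
  shows "v \<in> op_dom \<Omega>"
  using self_adjoint assms unfolding self_adjoint_op_def by blast

lemma eigenpair_inner:
  assumes f: "eigenpair \<Omega> M a0 \<nu> f" and v: "v \<in> op_dom \<Omega>"
  shows "L2_inner \<Omega> (T v) f = \<nu> * L2_inner \<Omega> v f"
proof -
  have f': "f \<in> op_dom \<Omega>" "L2_eq \<Omega> (T f) (\<lambda>x. \<nu> * f x)"
    using f by (auto simp: eigenpair_def)
  have "L2_inner \<Omega> (T v) f = L2_inner \<Omega> (T f) v"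
    unfolding op_symmetric[OF v f'(1)] by (rule L2_inner_commute)
  also have "\<dots> = L2_inner \<Omega> (\<lambda>x. \<nu> * f x) v"
    by (intro L2_eq_inner f' op_dom_L2 L2_scale v)
  finally show ?thesis by (simp add: L2_inner_scale L2_inner_commute)
qed

lemma basis: "L2_basis \<Omega> e"
  using eigenbasis op_dom_L2(1)
  unfolding L2_basis_def L2_orthonormal_def eigenbasis_def eigenpair_def by blast

lemma orthonormal: "L2_orthonormal \<Omega> e"
  using basis by (simp add: L2_basis_def)

lemma e_L2: "e m \<in> L2 \<Omega>"
  using orthonormal by (simp add: L2_orthonormal_def)

lemma e_eigenpair: "eigenpair \<Omega> M a0 (\<mu> m) (e m)"
  using eigenbasis by (simp add: eigenbasis_def)

lemma coeff_op: "v \<in> op_dom \<Omega> \<Longrightarrow> coeff (T v) m = \<mu> m * coeff v m"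
  by (rule eigenpair_inner[OF e_eigenpair])

text \<open>For the converse, Riesz-Fischer gives the candidate \<open>w\<close> for
  \<open>T v\<close>, and Parseval turns its coefficients into the adjoint relation, which by
  self-adjointness forces \<open>v\<close> into the domain.\<close>

lemma op_dom_iff:
  assumes v: "v \<in> L2 \<Omega>"
  shows "v \<in> op_dom \<Omega> \<longleftrightarrow> summable (\<lambda>m. (\<mu> m * coeff v m)\<^sup>2)"
proof
  assume "v \<in> op_dom \<Omega>"
  then show "summable (\<lambda>m. (\<mu> m * coeff v m)\<^sup>2)"
    using L2_Bessel[OF orthonormal op_dom_L2(2)] by (simp add: coeff_op)
next
  assume "summable (\<lambda>m. (\<mu> m * coeff v m)\<^sup>2)"
  then obtain w where w: "w \<in> L2 \<Omega>" "\<And>m. coeff w m = \<mu> m * coeff v m"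
    using L2_Riesz_Fischer[OF orthonormal, of "\<lambda>m. \<mu> m * coeff v m"] by blast
  show "v \<in> op_dom \<Omega>"
  proof (rule op_dom_adjoint[OF v w(1)])
    fix \<phi> assume \<phi>: "\<phi> \<in> op_dom \<Omega>"
    have "(\<lambda>m. coeff (T \<phi>) m * L2_inner \<Omega> (e m) v) sums L2_inner \<Omega> (T \<phi>) v"
      by (intro L2_Parseval basis op_dom_L2 \<phi> v)
    moreover have "coeff (T \<phi>) m * L2_inner \<Omega> (e m) v = coeff \<phi> m * L2_inner \<Omega> (e m) w" for m
      by (simp add: coeff_op[OF \<phi>] w(2) L2_inner_commute[of \<Omega> "e m"])
    ultimately have "(\<lambda>m. coeff \<phi> m * L2_inner \<Omega> (e m) w) sums L2_inner \<Omega> (T \<phi>) v" by simp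
    moreover have "(\<lambda>m. coeff \<phi> m * L2_inner \<Omega> (e m) w) sums L2_inner \<Omega> \<phi> w"
      by (intro L2_Parseval basis op_dom_L2 \<phi> w)
    ultimately show "L2_inner \<Omega> (T \<phi>) v = L2_inner \<Omega> \<phi> w" by (rule sums_unique2)
  qed
qed

text \<open>Eigenfunctions of two eigenbases are orthogonal unless their eigenvalues agree, which
  makes the powers independent of the eigenbasis.\<close>

lemma is_op_pow_iff:
  "is_op_pow \<Omega> M a0 s v w \<longleftrightarrow>
    v \<in> L2 \<Omega> \<and> w \<in> L2 \<Omega> \<and> (\<forall>m. coeff w m = \<mu> m powr s * coeff v m)"
proof (intro iffI conjI allI)
  assume pow: "is_op_pow \<Omega> M a0 s v w"
  then show v: "v \<in> L2 \<Omega>" and w: "w \<in> L2 \<Omega>" by (auto simp: is_op_pow_def)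
  fix n
  obtain \<nu> f where fb: "eigenbasis \<Omega> M a0 \<nu> f"
    and lim: "(\<lambda>N. L2_norm \<Omega> (\<lambda>x. w x - (\<Sum>m<N. (\<nu> m powr s * L2_inner \<Omega> v (f m)) * f m x)))
      \<longlonglongrightarrow> 0"
    using pow by (auto simp: is_op_pow_def)
  interpret f: elliptic_eigenbasis \<Omega> M a0 \<nu> f
    by unfold_locales (fact self_adjoint fb)+
  have orth: "\<nu> m = \<mu> n \<or> L2_inner \<Omega> (f m) (e n) = 0" for m
  proof -
    have "f m \<in> op_dom \<Omega>" "e n \<in> op_dom \<Omega>"
      using e_eigenpair f.e_eigenpair by (auto simp: eigenpair_def)
    then have "\<mu> n * L2_inner \<Omega> (f m) (e n) = \<nu> m * L2_inner \<Omega> (f m) (e n)"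
      using eigenpair_inner[OF e_eigenpair, of "f m" n] eigenpair_inner[OF f.e_eigenpair, of "e n" m]
        op_symmetric[of "f m" "e n"] by (metis L2_inner_commute)
    then show ?thesis by auto
  qed
  have "(\<lambda>N. L2_inner \<Omega> (\<lambda>x. \<Sum>m<N. (\<nu> m powr s * L2_inner \<Omega> v (f m)) * f m x) (e n))
      \<longlonglongrightarrow> coeff w n"
    by (intro L2_inner_tendsto always_eventually allI w e_L2 lim L2_orthonormal_combination(1)[OF f.orthonormal]) simp
  then have "(\<lambda>m. \<nu> m powr s * L2_inner \<Omega> v (f m) * L2_inner \<Omega> (f m) (e n)) sums coeff w n"
    unfolding sums_def by (simp add: L2_orthonormal_combination(2)[OF f.orthonormal _ e_L2])
  \<comment> \<open>Where \<open>\<nu> m\<close> and \<open>\<mu> n\<close> differ, the last factor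
    vanishes. So one eigenvalue replaces the other and leaves the sum, and Parseval's series in the
    basis \<open>f\<close> remains.\<close>
  moreover have "\<nu> m powr s * L2_inner \<Omega> v (f m) * L2_inner \<Omega> (f m) (e n)
      = \<mu> n powr s * (L2_inner \<Omega> v (f m) * L2_inner \<Omega> (f m) (e n))" for m
    using orth[of m] by auto
  moreover have "(\<lambda>m. \<mu> n powr s * (L2_inner \<Omega> v (f m) * L2_inner \<Omega> (f m) (e n)))
      sums (\<mu> n powr s * coeff v n)"
    by (intro sums_mult L2_Parseval f.basis v e_L2)
  ultimately show "coeff w n = \<mu> n powr s * coeff v n"
    using sums_unique2 by simp
next
  assume *: "v \<in> L2 \<Omega> \<and> w \<in> L2 \<Omega> \<and> (\<forall>m. coeff w m = \<mu> m powr s * coeff v m)"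
  with L2_basis_expansion[OF basis, of w] eigenbasis
  show "is_op_pow \<Omega> M a0 s v w"
    unfolding is_op_pow_def by auto
qed

lemma pow_dom_iff:
  assumes v: "v \<in> L2 \<Omega>"
  shows "v \<in> pow_dom \<Omega> M a0 s \<longleftrightarrow> summable (\<lambda>m. (\<mu> m powr s * coeff v m)\<^sup>2)"
proof
  assume "v \<in> pow_dom \<Omega> M a0 s"
  then obtain w where "w \<in> L2 \<Omega>" "\<And>m. coeff w m = \<mu> m powr s * coeff v m"
    by (auto simp: pow_dom_def is_op_pow_iff)
  then show "summable (\<lambda>m. (\<mu> m powr s * coeff v m)\<^sup>2)"
    using L2_Bessel[OF orthonormal, of w] by simp
next
  assume "summable (\<lambda>m. (\<mu> m powr s * coeff v m)\<^sup>2)"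
  from L2_Riesz_Fischer[OF orthonormal this] v show "v \<in> pow_dom \<Omega> M a0 s"
    by (auto simp: pow_dom_def is_op_pow_iff)
qed

lemma op_pow_L2:
  assumes "v \<in> pow_dom \<Omega> M a0 s"
  shows "op_pow \<Omega> M a0 s v \<in> L2 \<Omega>" "coeff (op_pow \<Omega> M a0 s v) m = \<mu> m powr s * coeff v m"
proof -
  have "is_op_pow \<Omega> M a0 s v (op_pow \<Omega> M a0 s v)"
    unfolding op_pow_def by (rule someI_ex[of "is_op_pow \<Omega> M a0 s v"]) (use assms in \<open>simp add: pow_dom_def\<close>)
  then show "op_pow \<Omega> M a0 s v \<in> L2 \<Omega>" "coeff (op_pow \<Omega> M a0 s v) m = \<mu> m powr s * coeff v m"
    by (auto simp: is_op_pow_iff)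
qed

text \<open>Treats \<open>A\<close> and its powers alike. Inside the domain this is Parseval;
  outside, the divergent series of squares has sum \<open>\<infinity>\<close>, in agreement with the
  convention in \<open>ext_norm\<close>.\<close>

lemma ext_norm_square:
  assumes "v \<in> D \<longleftrightarrow> summable (\<lambda>m. (c m)\<^sup>2)"
    and "v \<in> D \<Longrightarrow> B v \<in> L2 \<Omega>" and "\<And>m. v \<in> D \<Longrightarrow> coeff (B v) m = c m"
  shows "(ext_norm \<Omega> D B v)\<^sup>2 = (\<Sum>m. ennreal ((c m)\<^sup>2))"
proof (cases "v \<in> D")
  case True
  have "(\<lambda>m. (c m)\<^sup>2) sums (L2_norm \<Omega> (B v))\<^sup>2"
    using L2_Parseval_norm[OF basis assms(2)[OF True]] assms(3)[OF True] by simp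
  then have "(\<Sum>m. ennreal ((c m)\<^sup>2)) = ennreal ((L2_norm \<Omega> (B v))\<^sup>2)"
    by (intro suminf_ennreal_eq) auto
  also have "\<dots> = (ext_norm \<Omega> D B v)\<^sup>2"
    unfolding ext_norm_def by (simp only: if_P[OF True] ennreal_power L2_norm_nonneg)
  finally show ?thesis by (rule sym)
next
  case False
  then have "(\<Sum>m. ennreal ((c m)\<^sup>2)) = \<infinity>"
    using assms(1) by (simp add: summable_iff_suminf_neq_top)
  then show ?thesis using False by (simp add: ext_norm_def)
qed

lemma ext_norm_op_pow_square:
  assumes "v \<in> L2 \<Omega>"
  shows "(ext_norm \<Omega> (pow_dom \<Omega> M a0 s) (op_pow \<Omega> M a0 s) v)\<^sup>2
    = (\<Sum>m. ennreal ((\<mu> m powr s * coeff v m)\<^sup>2))"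
  by (intro ext_norm_square pow_dom_iff assms op_pow_L2)

lemma ext_norm_op_square:
  assumes "v \<in> L2 \<Omega>"
  shows "(ext_norm \<Omega> (op_dom \<Omega>) T v)\<^sup>2 = (\<Sum>m. ennreal ((\<mu> m * coeff v m)\<^sup>2))"
  by (intro ext_norm_square op_dom_iff assms op_dom_L2 coeff_op)

end

section \<open>The scalar damped oscillator\<close>

text \<open>The integral from \<open>0\<close> serves every \<open>t\<close> at once: near
  \<open>t\<close> the half-line coincides with \<open>{0..t + 1}\<close>, where the fundamental
  theorem applies.\<close>

lemma antiderivative_Ici:
  fixes f :: "real \<Rightarrow> real"
  assumes "continuous_on {0..} f"
  shows "\<exists>F. \<forall>t\<ge>0. (F has_real_derivative f t) (at t within {0..})"
proof (intro exI allI impI)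
  fix t :: real assume "t \<ge> 0"
  then have "((\<lambda>x. integral {0..x} f) has_real_derivative f t) (at t within {0..t + 1})"
    using assms by (intro integral_has_real_derivative) (auto intro: continuous_on_subset)
  moreover have "at t within {0..t + 1} = at t within {0..}"
    by (rule at_within_nhd[of _ "{..<t + 1}"]) auto
  ultimately show "((\<lambda>x. integral {0..x} f) has_real_derivative f t) (at t within {0..})"
    by simp
qed

lemma at_within_Ici_interior:
  fixes t :: real
  shows "t > 0 \<Longrightarrow> at t within {0..} = at t"
  by (rule at_within_interior) simp

lemma has_derivative_Ici_constant:
  fixes f :: "real \<Rightarrow> real"
  assumes cont: "continuous_on {0..} f"
    and der: "\<And>t. t > 0 \<Longrightarrow> (f has_real_derivative 0) (at t within {0..})"
    and t: "t \<ge> 0"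
  shows "f t = f 0"
proof (cases "t = 0")
  case False
  then show ?thesis
    using t der
    by (intro DERIV_isconst_end continuous_on_subset[OF cont]) (auto simp: at_within_Ici_interior)
qed simp

text \<open>Integrating the equation twice shows that \<open>x\<close> agrees with a twice differentiable function
  up to the endpoint, so no continuity of \<open>y\<close> at \<open>0\<close> is required.\<close>

lemma damped_oscillator_at_zero:
  fixes x y :: "real \<Rightarrow> real" and \<alpha> \<mu> :: real
  assumes x: "\<And>t. t \<ge> 0 \<Longrightarrow> (x has_real_derivative y t) (at t within {0..})"
    and y: "\<And>t. t > 0 \<Longrightarrow> (y has_real_derivative - \<alpha> * y t - \<mu> * x t) (at t within {0..})"
    and t: "t \<ge> 0"
  shows "(y has_real_derivative - \<alpha> * y t - \<mu> * x t) (at t within {0..})"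
proof -
  have "continuous_on {0..} x"
    using x by (intro DERIV_continuous_on) auto
  then obtain P where P: "\<And>t. t \<ge> 0 \<Longrightarrow> (P has_real_derivative x t) (at t within {0..})"
    using antiderivative_Ici by blast
  then have "continuous_on {0..} P"
    by (intro DERIV_continuous_on) auto
  then obtain Q where Q: "\<And>t. t \<ge> 0 \<Longrightarrow> (Q has_real_derivative P t) (at t within {0..})"
    using antiderivative_Ici by blast
  \<comment> \<open>A first integral: differentiating it gives the equation, so it is constant for
    \<open>t > 0\<close>.\<close>
  define g where "g t = y t + \<alpha> * x t + \<mu> * P t" for t
  have "\<exists>K. \<forall>t\<in>{0<..}. g t = K"
  proof (rule has_field_derivative_zero_constant)
    fix t :: real assume t: "t \<in> {0<..}"
    then have "(g has_real_derivative (- \<alpha> * y t - \<mu> * x t) + \<alpha> * y t + \<mu> * x t) (at t within {0..})"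
      unfolding g_def by (intro DERIV_add DERIV_cmult x y P) auto
    then show "(g has_real_derivative 0) (at t within {0<..})"
      by (auto intro: DERIV_subset)
  qed (rule convex_real_interval)
  then obtain K where K: "\<And>t. t > 0 \<Longrightarrow> g t = K" by auto
  \<comment> \<open>An antiderivative of \<open>g - K\<close>. Being built from \<open>x\<close>,
    \<open>P\<close> and \<open>Q\<close>, it is differentiable at \<open>0\<close> as well, where
    the value of \<open>g\<close> is still to be found.\<close>
  define h where "h t = x t + \<alpha> * P t + \<mu> * Q t - K * t" for t
  have h: "(h has_real_derivative g t - K) (at t within {0..})" if "t \<ge> 0" for t
    unfolding h_def g_def using that
    by (auto intro!: derivative_eq_intros x P Q)
  have h_const: "h 0 = h t" if "t \<ge> 0" for t
    using h K that
    by (intro has_derivative_Ici_constant[symmetric] DERIV_continuous_on[of _ h "\<lambda>t. g t - K"])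
       (auto, metis diff_self less_imp_le)
  \<comment> \<open>Since \<open>h\<close> is constant up to \<open>0\<close>, its one-sided
    derivative there, \<open>g 0 - K\<close>, must vanish.\<close>
  have "(h has_real_derivative 0) (at 0 within {0..})"
  proof (rule has_field_derivative_transform_within[where d = 1])
    show "((\<lambda>_. h 0) has_real_derivative 0) (at 0 within {0..})" by (rule DERIV_const)
  qed (use h_const in simp_all)
  moreover have "at (0::real) within {0..} \<noteq> bot"
    by (simp add: at_within_Ici_at_right)
  ultimately have "g 0 = K"
    using has_field_derivative_unique[OF h[of 0]] by fastforce
  then have "y t = K - \<alpha> * x t - \<mu> * P t" if "t \<ge> 0" for t
    using K[of t] that by (cases "t = 0") (auto simp: g_def)
  moreover have "((\<lambda>t. K - \<alpha> * x t - \<mu> * P t) has_real_derivative 0 - \<alpha> * y t - \<mu> * x t)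
      (at t within {0..})"
    by (intro DERIV_diff DERIV_cmult DERIV_const x P t)
  ultimately show ?thesis
    using t by (auto intro: has_field_derivative_transform_within[where d = 1])
qed

text \<open>The upper bounds on \<delta> are the two halves of the minimum in the theorem, the
  second one weakened from the principal eigenvalue to an arbitrary eigenvalue \<mu>.\<close>

lemma damped_oscillator_decay:
  fixes x y :: "real \<Rightarrow> real" and \<alpha> \<mu> \<delta> :: real
  assumes x: "\<And>t. t \<ge> 0 \<Longrightarrow> (x has_real_derivative y t) (at t within {0..})"
    and y: "\<And>t. t \<ge> 0 \<Longrightarrow> (y has_real_derivative - \<alpha> * y t - \<mu> * x t) (at t within {0..})"
    and \<delta>: "\<delta> > 0" and \<alpha>: "3 * \<delta> \<le> \<alpha>" and \<mu>: "6 * \<alpha> * \<delta> \<le> \<mu>" and t: "t \<ge> 0"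
  shows "(y t)\<^sup>2 + \<mu> * (x t)\<^sup>2 \<le> 3 * exp (- 2 * \<delta> * t) * ((y 0)\<^sup>2 + \<mu> * (x 0)\<^sup>2)"
proof -
  define F where "F t = (y t)\<^sup>2 + \<mu> * (x t)\<^sup>2" for t
  \<comment> \<open>The last term cancels the contribution of \<open>- \<alpha> y\<close> to the derivative of \<open>x y\<close>.\<close>
  define V where "V t = ((y t)\<^sup>2 + \<mu> * (x t)\<^sup>2) / 2
    + 3/2 * (\<delta> * (x t * y t)) + 3/4 * (\<delta> * \<alpha> * (x t)\<^sup>2)" for t
  define V' where "V' t = - (\<alpha> - 3/2 * \<delta>) * (y t)\<^sup>2 - 3/2 * \<delta> * \<mu> * (x t)\<^sup>2" for t
  \<comment> \<open>With \<open>\<delta>2\<close> this ranks the coefficients of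
    \<open>(x t)\<^sup>2\<close> that occur: \<open>18 * \<delta>\<^sup>2 \<le> 6 * \<delta> *
    \<alpha> \<le> \<mu>\<close>.\<close>
  have \<delta>\<alpha>: "6 * (\<delta> * \<alpha> * (x t)\<^sup>2) \<le> \<mu> * (x t)\<^sup>2" for t
    using mult_right_mono[OF \<mu>, of "(x t)\<^sup>2"] by (simp add: mult_ac)
  have \<delta>2: "3 * (\<delta>\<^sup>2 * (x t)\<^sup>2) \<le> \<delta> * \<alpha> * (x t)\<^sup>2" for t
    using mult_right_mono[OF mult_left_mono[OF \<alpha>, of \<delta>], of "(x t)\<^sup>2"] \<delta>
    by (simp add: power2_eq_square mult_ac)
  have V_lower: "5/16 * F t \<le> V t" for t
  proof -
    \<comment> \<open>With weight \<open>3/16\<close> this square reproduces the mixed term of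
      \<open>V\<close> and uses up exactly the surplus \<open>1/2 - 5/16\<close> of
      \<open>(y t)\<^sup>2\<close>.\<close>
    have "0 \<le> (y t + 4 * \<delta> * x t)\<^sup>2" by simp
    also have "\<dots> = (y t)\<^sup>2 + 8 * (\<delta> * (x t * y t)) + 16 * (\<delta>\<^sup>2 * (x t)\<^sup>2)"
      by (simp add: power2_eq_square algebra_simps)
    finally have sq: "0 \<le> (y t)\<^sup>2 + 8 * (\<delta> * (x t * y t)) + 16 * (\<delta>\<^sup>2 * (x t)\<^sup>2)" .
    \<comment> \<open>The monomials become independent variables, with \<open>b\<close> the mixed
      one and \<open>c\<close>, \<open>d\<close>, \<open>m\<close> multiples of
      \<open>(x t)\<^sup>2\<close>, so that only linear arithmetic is left.\<close>
    have lin: "5/16 * (a + m) \<le> (a + m) / 2 + 3/2 * b + 3/4 * c"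
      if "0 \<le> a + 8 * b + 16 * d" "6 * c \<le> m" "3 * d \<le> c" "0 \<le> d" for a b c d m :: real
      using that by argo
    show ?thesis
      unfolding F_def V_def by (rule lin[OF sq \<delta>\<alpha> \<delta>2]) simp
  qed
  have V_upper: "V t \<le> 15/16 * F t" for t
  proof -
    \<comment> \<open>Again with weight \<open>3/16\<close>, the square supplies the mixed term of
      \<open>15/16 * F t - V t\<close>; the surplus \<open>7/16 * \<mu>\<close> covers the negative
      multiples of \<open>(x t)\<^sup>2\<close>.\<close>
    have "0 \<le> (y t - 4 * \<delta> * x t)\<^sup>2" by simp
    also have "\<dots> = (y t)\<^sup>2 - 8 * (\<delta> * (x t * y t)) + 16 * (\<delta>\<^sup>2 * (x t)\<^sup>2)"
      by (simp add: power2_eq_square algebra_simps)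
    finally have sq: "0 \<le> (y t)\<^sup>2 - 8 * (\<delta> * (x t * y t)) + 16 * (\<delta>\<^sup>2 * (x t)\<^sup>2)" .
    have lin: "(a + m) / 2 + 3/2 * b + 3/4 * c \<le> 15/16 * (a + m)"
      if "0 \<le> a - 8 * b + 16 * d" "6 * c \<le> m" "3 * d \<le> c" "0 \<le> d" "0 \<le> a" for a b c d m :: real
      using that by argo
    show ?thesis
      unfolding F_def V_def by (rule lin[OF sq \<delta>\<alpha> \<delta>2]) simp_all
  qed
  have V_deriv: "(V has_real_derivative V' t) (at t within {0..})" if "t \<ge> 0" for t
    unfolding V_def V'_def
    by (auto intro!: derivative_eq_intros x y that simp: field_simps power2_eq_square)
  have dissipation: "2 * \<delta> * V t + V' t \<le> 0" for t
  proof -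
    \<comment> \<open>Half of this square absorbs the mixed term. What remains is at most \<open>-
      (\<alpha> - 3 * \<delta>) * (y t)\<^sup>2 - \<delta> / 2 * (\<mu> - 6 * \<alpha> * \<delta>) *
      (x t)\<^sup>2\<close>, so both bounds on \<delta> enter with their exact constants.\<close>
    have "0 \<le> \<delta> * (y t - 3 * \<delta> * x t)\<^sup>2" using \<delta> by simp
    also have "\<dots> = \<delta> * (y t)\<^sup>2 - 6 * (\<delta> * (\<delta> * (x t * y t))) + 9 * (\<delta> * (\<delta>\<^sup>2 * (x t)\<^sup>2))"
      by (simp add: power2_eq_square algebra_simps)
    finally have sq: "0 \<le> \<delta> * (y t)\<^sup>2 - 6 * (\<delta> * (\<delta> * (x t * y t))) + 9 * (\<delta> * (\<delta>\<^sup>2 * (x t)\<^sup>2))" .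
    have d: "3 * (\<delta> * (\<delta>\<^sup>2 * (x t)\<^sup>2)) \<le> \<delta> * (\<delta> * \<alpha> * (x t)\<^sup>2)"
      using mult_left_mono[OF \<delta>2[of t], of \<delta>] \<delta> by simp
    have m: "6 * (\<delta> * (\<delta> * \<alpha> * (x t)\<^sup>2)) \<le> \<delta> * (\<mu> * (x t)\<^sup>2)"
      using mult_left_mono[OF \<delta>\<alpha>[of t], of \<delta>] \<delta> by simp
    have a: "3 * (\<delta> * (y t)\<^sup>2) \<le> \<alpha> * (y t)\<^sup>2"
      using mult_right_mono[OF \<alpha>, of "(y t)\<^sup>2"] by simp
    have "2 * \<delta> * V t + V' t = 5/2 * (\<delta> * (y t)\<^sup>2) - \<alpha> * (y t)\<^sup>2 - 1/2 * (\<delta> * (\<mu> * (x t)\<^sup>2))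
        + 3 * (\<delta> * (\<delta> * (x t * y t))) + 3/2 * (\<delta> * (\<delta> * \<alpha> * (x t)\<^sup>2))"
      unfolding V_def V'_def by (simp add: field_simps)
    also have "\<dots> \<le> 0"
    proof -
      have "5/2 * a - a' - 1/2 * m + 3 * b + 3/2 * c \<le> 0"
        if "0 \<le> a - 6 * b + 9 * d" "3 * d \<le> c" "6 * c \<le> m" "3 * a \<le> a'" for a a' b c d m :: real
        using that by argo
      from this[OF sq d m a] show ?thesis .
    qed
    finally show ?thesis .
  qed
  define W where "W t = exp (2 * \<delta> * t) * V t" for t
  have W_deriv: "(W has_real_derivative exp (2 * \<delta> * t) * (2 * \<delta> * V t + V' t)) (at t within {0..})"
    if "t \<ge> 0" for t
    unfolding W_def by (auto intro!: derivative_eq_intros V_deriv that simp: algebra_simps)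
  have "W t \<le> W 0"
  proof (cases "t = 0")
    case False
    with t have "0 < t" by simp
    then show ?thesis
    proof (rule DERIV_nonpos_imp_decreasing_open[OF less_imp_le])
      show "\<exists>y. DERIV W s :> y \<and> y \<le> 0" if "0 < s" for s
        using W_deriv[of s] that dissipation[of s]
        by (intro exI[of _ "exp (2 * \<delta> * s) * (2 * \<delta> * V s + V' s)"])
           (auto simp: at_within_Ici_interior mult_le_0_iff)
      have "continuous_on {0..} W"
        using W_deriv by (intro DERIV_continuous_on) auto
      then show "continuous_on {0..t} W" by (rule continuous_on_subset) auto
    qed
  qed simp
  then have "exp (2 * \<delta> * t) * V t \<le> V 0" by (simp add: W_def)
  moreover have "exp (2 * \<delta> * t) * (5/16 * F t) \<le> exp (2 * \<delta> * t) * V t"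
    by (intro mult_left_mono V_lower) simp
  ultimately have "exp (2 * \<delta> * t) * F t \<le> 3 * F 0"
    using V_upper[of 0] by argo
  then have "exp (- 2 * \<delta> * t) * (exp (2 * \<delta> * t) * F t) \<le> exp (- 2 * \<delta> * t) * (3 * F 0)"
    by (intro mult_left_mono) auto
  moreover have "exp (- 2 * \<delta> * t) * (exp (2 * \<delta> * t) * F t) = F t"
    by (simp add: exp_minus)
  moreover have "exp (- 2 * \<delta> * t) * (3 * F 0) = 3 * exp (- 2 * \<delta> * t) * F 0"
    by (rule mult.left_commute[THEN trans]) (rule mult.assoc[symmetric])
  ultimately show ?thesis unfolding F_def by metis
qed

section \<open>Time derivatives of the coefficients\<close>

text \<open>Pairing with a fixed \<open>g\<close> is linear and continuous in the norm, so it
  commutes with the limit of difference quotients.\<close>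

lemma has_time_deriv_inner:
  assumes u: "has_time_deriv \<Omega> u v t" and t: "t \<ge> 0" and g: "g \<in> L2 \<Omega>"
  shows "((\<lambda>s. L2_inner \<Omega> (u s) g) has_real_derivative L2_inner \<Omega> v g) (at t within {0..})"
proof -
  have uL: "\<And>s. s \<ge> 0 \<Longrightarrow> u s \<in> L2 \<Omega>" and v: "v \<in> L2 \<Omega>"
    and lim: "((\<lambda>s. L2_norm \<Omega> (\<lambda>x. (u s x - u t x) / (s - t) - v x)) \<longlongrightarrow> 0) (at t within {0..})"
    using u by (auto simp: has_time_deriv_def)
  have quot: "(\<lambda>x. (u s x - u t x) / (s - t)) \<in> L2 \<Omega>" if "s \<ge> 0" for s
    using L2_scale[OF L2_diff[OF uL[OF that] uL[OF t]], of "1 / (s - t)"] by simp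
  have in_Ici: "\<forall>\<^sub>F s in at t within {0..}. s \<ge> 0"
    by (simp add: eventually_at_filter)
  have "((\<lambda>s. L2_inner \<Omega> (\<lambda>x. (u s x - u t x) / (s - t)) g) \<longlongrightarrow> L2_inner \<Omega> v g) (at t within {0..})"
  proof (rule L2_inner_tendsto[OF _ v g])
    show "\<forall>\<^sub>F s in at t within {0..}. (\<lambda>x. (u s x - u t x) / (s - t)) \<in> L2 \<Omega>"
      using in_Ici by (rule eventually_mono) (rule quot)
    show "((\<lambda>s. L2_norm \<Omega> (\<lambda>x. v x - (u s x - u t x) / (s - t))) \<longlongrightarrow> 0) (at t within {0..})"
      using lim by (subst L2_norm_minus_commute)
  qed
  then show ?thesis
    unfolding has_field_derivative_iff
  proof (rule Lim_transform_eventually)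
    show "\<forall>\<^sub>F s in at t within {0..}. L2_inner \<Omega> (\<lambda>x. (u s x - u t x) / (s - t)) g
        = (L2_inner \<Omega> (u s) g - L2_inner \<Omega> (u t) g) / (s - t)"
      using in_Ici
    proof eventually_elim
      case (elim s)
      have "L2_inner \<Omega> (\<lambda>x. (u s x - u t x) / (s - t)) g
          = L2_inner \<Omega> (\<lambda>x. 1 / (s - t) * (u s x - u t x)) g" by simp
      then show ?case
        unfolding L2_inner_scale L2_inner_diff[OF uL[OF elim] uL[OF t] g] by simp
    qed
  qed
qed

lemma has_time_deriv_time_deriv_n:
  assumes "has_time_deriv \<Omega> (time_deriv_n \<Omega> i u) v t"
  shows "has_time_deriv \<Omega> (time_deriv_n \<Omega> i u) (time_deriv_n \<Omega> (Suc i) u t) t"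
  using someI[of "\<lambda>v. has_time_deriv \<Omega> (time_deriv_n \<Omega> i u) v t", OF assms]
  by (simp add: time_deriv_n_def time_deriv_def)

lemma time_differentiable_nD:
  assumes "time_differentiable_n \<Omega> j u" "i < j" "t \<ge> 0"
  shows "has_time_deriv \<Omega> (time_deriv_n \<Omega> i u) (time_deriv_n \<Omega> (Suc i) u t) t"
  using assms has_time_deriv_time_deriv_n unfolding time_differentiable_n_def by blast

lemma time_deriv_n_L2:
  assumes u: "time_differentiable_n \<Omega> j u" and j: "j \<ge> 1" and "i \<le> j" and t: "t \<ge> 0"
  shows "time_deriv_n \<Omega> i u t \<in> L2 \<Omega>"
proof (cases i)
  case 0
  then show ?thesis using time_differentiable_nD[OF u, of 0] j t by (simp add: has_time_deriv_def)
next
  case (Suc k)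
  then show ?thesis
    using time_differentiable_nD[OF u, of k] \<open>i \<le> j\<close> t by (simp add: has_time_deriv_def)
qed

context elliptic_eigenbasis
begin

text \<open>The base case tests the wave equation with \<open>e m\<close>. The resulting scalar
  equation has constant coefficients and is therefore inherited by each further derivative.\<close>

lemma damped_wave_coeff:
  fixes m :: nat
  assumes sol: "damped_wave_solution \<Omega> M a0 \<alpha> u0 u1 u"
    and diff: "time_differentiable_n \<Omega> j u" and "i < j" and "t \<ge> 0"
  defines "x \<equiv> \<lambda>i t. coeff (time_deriv_n \<Omega> i u t) m"
  shows "(x i has_real_derivative x (Suc i) t) (at t within {0..})"
    and "(x (Suc i) has_real_derivative - \<alpha> * x (Suc i) t - \<mu> m * x i t) (at t within {0..})"
proof -
  have deriv: "(x i has_real_derivative x (Suc i) t) (at t within {0..})" if "i < j" "t \<ge> 0" for i t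
    unfolding x_def by (intro has_time_deriv_inner time_differentiable_nD[OF diff] that e_L2)
  then show "(x i has_real_derivative x (Suc i) t) (at t within {0..})"
    using assms by blast
  have j: "j \<ge> 1" using \<open>i < j\<close> by simp
  show "(x (Suc i) has_real_derivative - \<alpha> * x (Suc i) t - \<mu> m * x i t) (at t within {0..})"
    using \<open>i < j\<close> \<open>t \<ge> 0\<close>
  proof (induction i arbitrary: t)
    case 0
    \<comment> \<open>The wave equation is given for \<open>t > 0\<close>; the rule carries its
      scalar form over to \<open>0\<close>.\<close>
    show ?case
    proof (rule damped_oscillator_at_zero)
      show "(x 0 has_real_derivative x (Suc 0) t) (at t within {0..})" if "t \<ge> 0" for t
        using that 0 by (intro deriv)
      fix t :: real assume t: "t > 0"
      let ?D = "\<lambda>i. time_deriv_n \<Omega> i u t"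
      \<comment> \<open>This comes from the notion of solution: for \<open>j = 1\<close>,
        \<open>diff\<close> says nothing about a second derivative.\<close>
      have second: "has_time_deriv \<Omega> (time_deriv_n \<Omega> (Suc 0) u) (?D 2) t"
        using sol t has_time_deriv_time_deriv_n[of \<Omega> 1 u _ t]
        unfolding damped_wave_solution_def numeral_2_eq_2 by auto
      have dom: "u t \<in> op_dom \<Omega>"
        and eq: "L2_eq \<Omega> (\<lambda>x. ?D 2 x + \<alpha> * ?D 1 x + T (u t) x) (\<lambda>x. 0)"
        using sol t by (auto simp: damped_wave_solution_def)
      have Tu: "T (u t) \<in> L2 \<Omega>" by (rule op_dom_L2(2)[OF dom])
      have L2: "?D 1 \<in> L2 \<Omega>" "?D 2 \<in> L2 \<Omega>"
        using second time_deriv_n_L2[OF diff j, of 1] j t by (auto simp: has_time_deriv_def)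
      have "0 = coeff (\<lambda>x. ?D 2 x + \<alpha> * ?D 1 x + T (u t) x) m"
        by (subst L2_eq_inner[OF eq]) (intro L2_add L2_scale L2 Tu L2_zero e_L2 | simp)+
      also have "\<dots> = coeff (?D 2) m + \<alpha> * coeff (?D 1) m + \<mu> m * coeff (u t) m"
        by (simp add: L2_inner_add L2_inner_scale L2_add L2_scale L2[unfolded One_nat_def] Tu e_L2 coeff_op[OF dom])
      finally have "coeff (?D 2) m = - \<alpha> * x (Suc 0) t - \<mu> m * x 0 t"
        by (simp add: x_def time_deriv_n_def)
      moreover have "(x (Suc 0) has_real_derivative coeff (?D 2) m) (at t within {0..})"
        unfolding x_def using t by (intro has_time_deriv_inner second e_L2) simp
      ultimately show "(x (Suc 0) has_real_derivative - \<alpha> * x (Suc 0) t - \<mu> m * x 0 t)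
          (at t within {0..})" by simp
    qed (use 0 in simp)
  next
    case (Suc i)
    \<comment> \<open>Uniqueness of derivatives expresses order \<open>i + 2\<close> by lower
      orders. That order may be \<open>j\<close> itself, whose derivative is then read off from this
      formula.\<close>
    have eq: "x (Suc (Suc i)) t = - \<alpha> * x (Suc i) t - \<mu> m * x i t" if t: "t \<ge> 0" for t
    proof (rule has_field_derivative_unique)
      show "(x (Suc i) has_real_derivative x (Suc (Suc i)) t) (at t within {0..})"
        using Suc.prems t by (intro deriv) auto
      show "(x (Suc i) has_real_derivative - \<alpha> * x (Suc i) t - \<mu> m * x i t) (at t within {0..})"
        using Suc.prems t by (intro Suc.IH) auto
      show "at t within {0..} \<noteq> bot"
        using t by (cases "t = 0") (auto simp: at_within_Ici_at_right at_within_Ici_interior)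
    qed
    have "((\<lambda>t. - \<alpha> * x (Suc i) t - \<mu> m * x i t) has_real_derivative
        - \<alpha> * x (Suc (Suc i)) t - \<mu> m * x (Suc i) t) (at t within {0..})"
      using Suc.prems by (intro DERIV_diff DERIV_cmult deriv) auto
    then show ?case
      by (rule has_field_derivative_transform_within[where d = 1]) (use Suc.prems in \<open>auto simp: eq\<close>)
  qed
qed

section \<open>Summation over the modes and decay of the energies\<close>

lemma energy_Ak_decay:
  assumes sol: "damped_wave_solution \<Omega> M a0 \<alpha> u0 u1 u"
    and diff: "time_differentiable_n \<Omega> j u" and j: "j \<ge> 1" and t: "t \<ge> 0"
    and \<delta>: "\<delta> > 0" "3 * \<delta> \<le> \<alpha>" and \<mu>: "\<And>m. 6 * \<alpha> * \<delta> \<le> \<mu> m"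
  shows "energy_Ak \<Omega> M a0 k j u t \<le> ennreal (3 * exp (- 2 * \<delta> * t)) * energy_Ak \<Omega> M a0 k j u 0"
proof -
  let ?c = "3 * exp (- 2 * \<delta> * t)"
  define x where "x i s m = coeff (time_deriv_n \<Omega> i u s) m" for i s m
  define E where "E s m = (\<mu> m powr (k - 1/2) * x j s m)\<^sup>2 + (\<mu> m powr k * x (j - 1) s m)\<^sup>2" for s m
  have \<mu>_pos: "\<mu> m > 0" for m
    using \<delta> by (intro less_le_trans[OF _ \<mu>]) simp
  \<comment> \<open>Positivity of \<open>\<mu> m\<close> splits one factor \<open>\<mu> m\<close>
    off the power, so the common weight multiplies the energy of a single oscillator.\<close>
  have E_eq: "E s m = \<mu> m powr (2 * k - 1) * ((x j s m)\<^sup>2 + \<mu> m * (x (j - 1) s m)\<^sup>2)" for s m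
  proof -
    have "(\<mu> m powr (k - 1/2))\<^sup>2 = \<mu> m powr (2 * k - 1)"
      using \<mu>_pos[of m] by (simp add: power2_eq_square powr_add[symmetric])
    moreover have "(\<mu> m powr k)\<^sup>2 = \<mu> m powr (2 * k - 1) * \<mu> m"
      using \<mu>_pos[of m] by (simp add: power2_eq_square powr_add[symmetric] powr_diff)
    ultimately show ?thesis
      by (simp add: E_def power_mult_distrib algebra_simps)
  qed
  have energy: "energy_Ak \<Omega> M a0 k j u s = (1/2) * (\<Sum>m. ennreal (E s m))" if s: "s \<ge> 0" for s
  proof -
    have L2: "time_deriv_n \<Omega> j u s \<in> L2 \<Omega>" "time_deriv_n \<Omega> (j - 1) u s \<in> L2 \<Omega>"
      using time_deriv_n_L2[OF diff j _ s] by auto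
    show ?thesis
      unfolding energy_Ak_def ext_norm_op_pow_square[OF L2(1)] ext_norm_op_pow_square[OF L2(2)]
      by (simp add: suminf_add[OF summableI summableI] E_def x_def ennreal_plus[symmetric] del: ennreal_plus)
  qed
  have "E t m \<le> ?c * E 0 m" for m
  proof -
    have "(x j t m)\<^sup>2 + \<mu> m * (x (j - 1) t m)\<^sup>2 \<le> ?c * ((x j 0 m)\<^sup>2 + \<mu> m * (x (j - 1) 0 m)\<^sup>2)"
    proof (rule damped_oscillator_decay[where x = "\<lambda>s. x (j - 1) s m" and y = "\<lambda>s. x j s m"])
      fix s :: real assume s: "s \<ge> 0"
      have j': "Suc (j - 1) = j" using j by simp
      show "((\<lambda>s. x (j - 1) s m) has_real_derivative x j s m) (at s within {0..})"
        and "((\<lambda>s. x j s m) has_real_derivative - \<alpha> * x j s m - \<mu> m * x (j - 1) s m) (at s within {0..})"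
        using damped_wave_coeff[OF sol diff, of "j - 1" s m] j s unfolding x_def j' by auto
    qed (use \<delta> \<mu> t in auto)
    from mult_left_mono[OF this, of "\<mu> m powr (2 * k - 1)"] show ?thesis
      by (simp add: E_eq mult.left_commute)
  qed
  \<comment> \<open>The comparison takes place in \<open>ennreal\<close>, so an infinite initial
    energy is covered too.\<close>
  then have "(\<Sum>m. ennreal (E t m)) \<le> (\<Sum>m. ennreal ?c * ennreal (E 0 m))"
    by (intro suminf_le) (auto simp: ennreal_mult'[symmetric] intro!: ennreal_leI)
  also have "\<dots> = ennreal ?c * (\<Sum>m. ennreal (E 0 m))" by simp
  finally show ?thesis
    unfolding energy[OF t] energy[OF order_refl] mult.left_commute[of "ennreal ?c"]
    by (rule mult_left_mono) simp
qed

text \<open>Reduces part (i) to the decay for general real \<open>k\<close>: as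
  \<open>\<mu> m powr 1 = \<mu> m\<close> for positive eigenvalues, \<open>A\<close> and its first
  power have the same coefficient series.\<close>

lemma energy_A_eq_energy_Ak:
  assumes diff: "time_differentiable_n \<Omega> j u" and j: "j \<ge> 1" and t: "t \<ge> 0"
    and \<mu>: "\<And>m. 0 < \<mu> m"
  shows "energy_A \<Omega> M a0 j u t = energy_Ak \<Omega> M a0 1 j u t"
proof -
  have "time_deriv_n \<Omega> (j - 1) u t \<in> L2 \<Omega>"
    using time_deriv_n_L2[OF diff j _ t] by simp
  then show ?thesis
    using \<mu> by (simp add: energy_A_def energy_Ak_def ext_norm_op_square ext_norm_op_pow_square less_imp_le)
qed

end

lemma ext_norm_no_eigenbasis:
  assumes "\<not> (\<exists>\<mu> e. eigenbasis \<Omega> M a0 \<mu> e)"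
  shows "ext_norm \<Omega> (pow_dom \<Omega> M a0 s) B v = \<infinity>"
  using assms by (auto simp: ext_norm_def pow_dom_def is_op_pow_def)

theorem mainTheorem4:
  fixes \<Omega> :: "(real^'n) set"
    and M :: "real^'n \<Rightarrow> real^'n^'n" and a0 :: "real^'n \<Rightarrow> real"
    and \<alpha> \<delta> \<mu>1 :: real
    and u0 u1 :: "real^'n \<Rightarrow> real" and u :: "real \<Rightarrow> real^'n \<Rightarrow> real"
    and j :: nat
  assumes "convex_polyhedral_domain \<Omega>"
    and "elliptic_coefficients \<Omega> M a0"
    and "self_adjoint_op \<Omega> (op_dom \<Omega>) (ell_op \<Omega> M a0)"
    and "principal_eigenvalue \<Omega> M a0 \<mu>1"
    and "\<alpha> > 0"
    and "damped_wave_solution \<Omega> M a0 \<alpha> u0 u1 u"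
    and "0 < \<delta>" and "\<delta> \<le> 1/3 * min \<alpha> (\<mu>1 / (2 * \<alpha>))"
    and "j \<ge> 1" and "time_differentiable_n \<Omega> j u"
  shows "(\<forall>t\<ge>0. energy_A \<Omega> M a0 j u t
                 \<le> ennreal (3 * exp (- 2 * \<delta> * t)) * energy_A \<Omega> M a0 j u 0) \<and>
         (\<forall>k::real. k > 1 \<longrightarrow> u0 \<in> pow_dom \<Omega> M a0 k \<longrightarrow> u1 \<in> pow_dom \<Omega> M a0 (k - 1/2) \<longrightarrow>
            (\<forall>t\<ge>0. energy_Ak \<Omega> M a0 k j u t
                     \<le> ennreal (3 * exp (- 2 * \<delta> * t)) * energy_Ak \<Omega> M a0 k j u 0))"
proof (cases "\<exists>\<mu> e. eigenbasis \<Omega> M a0 \<mu> e")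
  case False
  \<comment> \<open>Without an eigenbasis the domains of the powers are empty by definition.\<close>
  have "energy_A \<Omega> M a0 j u t = \<infinity>" "energy_Ak \<Omega> M a0 k j u t = \<infinity>" for k t
    by (simp_all add: energy_A_def energy_Ak_def ext_norm_no_eigenbasis[OF False]
        ennreal_mult_top ennreal_divide_eq_0_iff)
  \<comment> \<open>The exponential factor is nonzero, so the right-hand sides are infinite as
    well.\<close>
  then show ?thesis by (simp add: ennreal_mult_top)
next
  case True
  then obtain \<mu> e where basis: "eigenbasis \<Omega> M a0 \<mu> e" by blast
  interpret elliptic_eigenbasis \<Omega> M a0 \<mu> e
    by unfold_locales (fact assms(3) basis)+
  have \<delta>: "3 * \<delta> \<le> \<alpha>" and "3 * \<delta> \<le> \<mu>1 / (2 * \<alpha>)" using assms(8) by linarith+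
  then have "6 * \<alpha> * \<delta> \<le> \<mu>1" using \<open>\<alpha> > 0\<close> by (simp add: field_simps)
  moreover have "\<mu>1 \<le> \<mu> m" for m
    using assms(4) e_eigenpair unfolding principal_eigenvalue_def by blast
  ultimately have \<mu>: "6 * \<alpha> * \<delta> \<le> \<mu> m" for m by (meson order_trans)
  have \<mu>_pos: "0 < \<mu> m" for m
    using \<open>\<alpha> > 0\<close> \<open>0 < \<delta>\<close> by (intro less_le_trans[OF _ \<mu>]) simp
  have decay: "energy_Ak \<Omega> M a0 k j u t
      \<le> ennreal (3 * exp (- 2 * \<delta> * t)) * energy_Ak \<Omega> M a0 k j u 0" if "t \<ge> 0" for k t
    using that assms \<delta> \<mu> by (intro energy_Ak_decay) auto
  then show ?thesis
    using energy_A_eq_energy_Ak[OF assms(10,9) _ \<mu>_pos] by auto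
qed

end
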